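(* Let $\alpha=\tfrac12$ and $\zeta=1-2(2^{1/2}-1)$. There exist $\theta_0>0$, $\beta_0$ and constants $c_0,c_1,c_2>0$ such that for all $0<\theta\le\theta_0$ and all $\beta>\beta_0$ with $\beta\ge \zeta/(2^8\theta^2)$, there is an event of $\mathbb P$-probability at least $1-e^{-c_0/\theta^2}$ on which the $\mu$-probability of the set of configurations $\sigma$ for which the run $\mathcal L_1$ containing the origin satisfies $$\exp\left(\frac{c_1}{\theta^2}\right)\le|\mathcal L_1|\le\exp\left(\frac{c_2}{\theta^2}\right)$$ is at least $1-e^{-c_0/\theta^2}$.
   Context: Random field Ising chain. $(\Omega,\mathcal A,\mathbb P)$ is a probability space carrying i.i.d. random variables $h=(h_i)_{i\in\mathbb Z}$ with $\mathbb P[h_i=1]=\mathbb P[h_i=-1]=\tfrac12$. Spin configurations are $\sigma\in\{-1,+1\}^{\mathbb Z}$. The pair interaction is $J(1)$, a fixed constant assumed large ($J(1)\gg1$), and $J(n)=n^{-2+\alpha}$ for $n>1$ (here $\alpha=1/2$). For finite $\Lambda\subset\mathbb Z$, $\theta>0$ and boundary configuration $\eta$, $$H^\eta(\sigma_\Lambda)=\tfrac12\sum_{(i,j)\in\Lambda\times\Lambda}J(|i-j|)(1-\sigma_i\sigma_j)-\theta\sum_{i\in\Lambda}h_i\sigma_i+\sum_{i\in\Lambda}\sum_{j\notin\Lambda}J(|i-j|)(1-\sigma_i\eta_j),$$ and $\mu^\eta_\Lambda(\sigma_\Lambda)=e^{-\beta H^\eta(\sigma_\Lambda)}/Z^\eta_\Lambda$.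 For $\mathbb P$-a.e. $h$ there is a unique infinite-volume Gibbs measure, denoted $\mu$. A run is a maximal set of consecutive sites on which $\sigma$ is constant; $\mathcal L_1$ denotes the run containing the origin. *)

theory Defs
  imports "HOL-Probability.Probability"
begin

text \<open>Pair interaction: J(1) = J1 (a large constant), J(n) = n powr (-2 + alpha)
  for n > 1 with alpha = 1/2.  The value at 0 is irrelevant (it is always
  multiplied by 1 - sigma_i sigma_i = 0); we set it to 0.\<close>
definition rfi_alpha :: real where "rfi_alpha = 1/2"

definition Jint :: "real \<Rightarrow> nat \<Rightarrow> real" where
  "Jint J1 n = (if n = 0 then 0 else if n = 1 then J1 else real n powr (-2 + rfi_alpha))"

definition spin_space :: "(int \<Rightarrow> real) measure" where
  "spin_space = (\<Pi>\<^sub>M i\<in>(UNIV::int set). count_space {-1, 1})"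

definition merge_conf :: "int set \<Rightarrow> (int \<Rightarrow> real) \<Rightarrow> (int \<Rightarrow> real) \<Rightarrow> (int \<Rightarrow> real)" where
  "merge_conf Lam tau eta = (\<lambda>i. if i \<in> Lam then tau i else eta i)"

text \<open>Finite-volume Hamiltonian H^eta(sigma_Lambda), evaluated at the merged
  configuration sig (sig = sigma on Lambda, eta outside Lambda).\<close>
definition hamiltonian ::
  "real \<Rightarrow> real \<Rightarrow> (int \<Rightarrow> real) \<Rightarrow> int set \<Rightarrow> (int \<Rightarrow> real) \<Rightarrow> real" where
  "hamiltonian J1 \<theta> h Lam sig =
     (1/2) * (\<Sum>i\<in>Lam. \<Sum>j\<in>Lam. Jint J1 (nat \<bar>i - j\<bar>) * (1 - sig i * sig j))
     - \<theta> * (\<Sum>i\<in>Lam. h i * sig i)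
     + (\<Sum>i\<in>Lam. infsum (\<lambda>j. Jint J1 (nat \<bar>i - j\<bar>) * (1 - sig i * sig j)) (- Lam))"

definition partition_fn ::
  "real \<Rightarrow> real \<Rightarrow> real \<Rightarrow> (int \<Rightarrow> real) \<Rightarrow> int set \<Rightarrow> (int \<Rightarrow> real) \<Rightarrow> real" where
  "partition_fn J1 \<beta> \<theta> h Lam eta =
     (\<Sum>tau\<in>(\<Pi>\<^sub>E i\<in>Lam. {-1, 1}). exp (- \<beta> * hamiltonian J1 \<theta> h Lam (merge_conf Lam tau eta)))"

definition gibbs_kernel ::
  "real \<Rightarrow> real \<Rightarrow> real \<Rightarrow> (int \<Rightarrow> real) \<Rightarrow> int set \<Rightarrow> (int \<Rightarrow> real) \<Rightarrow> (int \<Rightarrow> real) set \<Rightarrow> real" where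
  "gibbs_kernel J1 \<beta> \<theta> h Lam eta A =
     (\<Sum>tau\<in>(\<Pi>\<^sub>E i\<in>Lam. {-1, 1}).
        exp (- \<beta> * hamiltonian J1 \<theta> h Lam (merge_conf Lam tau eta))
        * indicator A (merge_conf Lam tau eta)) / partition_fn J1 \<beta> \<theta> h Lam eta"

definition gibbs_measure ::
  "real \<Rightarrow> real \<Rightarrow> real \<Rightarrow> (int \<Rightarrow> real) \<Rightarrow> (int \<Rightarrow> real) measure \<Rightarrow> bool" where
  "gibbs_measure J1 \<beta> \<theta> h \<mu> \<longleftrightarrow>
     prob_space \<mu> \<and> sets \<mu> = sets spin_space \<and>
     (\<forall>Lam. finite Lam \<longrightarrow> (\<forall>A\<in>sets spin_space.
        measure \<mu> A = (\<integral>eta. gibbs_kernel J1 \<beta> \<theta> h Lam eta A \<partial>\<mu>)))"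

definition run0 :: "(int \<Rightarrow> real) \<Rightarrow> int set" where
  "run0 sig = {i. \<forall>k. min 0 i \<le> k \<and> k \<le> max 0 i \<longrightarrow> sig k = sig 0}"

end

theory Submission
  imports Defs
begin

text \<open>
  All estimates on a Gibbs measure come from one comparison: given the spins outside a finite set,
  the probability that the spins inside are constantly \<open>s\<close> is at most \<open>exp (- \<beta> D)\<close>, where \<open>D\<close> is the
  energy gained by flipping the set.

  Upper bound: at scale \<open>exp (C / \<theta>\<^sup>2)\<close> one finds, on both sides of the origin, blocks of length of
  order \<open>1 / \<theta>\<^sup>2\<close> on which the field is constant of either sign; on such a block the field energy
  beats the boundary energy, so no long run contains it.

  Lower bound: up to scale \<open>N = exp (c / \<theta>\<^sup>2)\<close> the field satisfies \<open>\<theta> \<bar>\<Sum>h\<bar> \<le> \<surd>d\<close> on every interval of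
  length \<open>d\<close>, and then a run that is not longer than its two neighbours can be flipped with gain at
  least \<open>4\<close>.  Hence runs near the origin have a strictly shorter neighbour, which is impossible
  unless they are longer than \<open>\<surd>N\<close>: there is at most one wall in a window of size about \<open>\<surd>N\<close>.  A
  single wall is almost free to move, so it leaves the neighbourhood of the origin, because the
  partial sums of the field exceed any moderate level before the window ends.
\<close>

section \<open>Interaction and flips\<close>

text \<open>Three nested scales carry the lower bound. The run is to exceed M = exp (c /
  \<theta>^2). A wall within distance M is moved right by D <= 2 M^4: for each sign, the partial
  sums starting at M climb by 3 M within M^4 steps except with probability at most 6 / M, which is
  exponentially small in 1 / \<theta>^2. The move costs only bounded far-field energy if the wall is
  alone in a window leaving room D^2 on both sides, hence R = M^10. Being alone in {-R..<R} needs
  runs of length up to 2 R to be excluded, with descent room (2 R)^2, hence N = M^22. The union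
  bound over about N^2 = M^44 intervals has to be beaten twice: by exp (- 1 / (2 \<theta>^2)) from
  the field and by exp (- 4 \<beta>) from the flip comparison with gain 4. Since \<beta> may be as
  small as a fixed multiple of 1 / \<theta>^2, this forces c to be small.\<close>

lemma inverse_cube_bounds:
  fixes a b :: real
  assumes "0 < a" "a \<le> b" "b\<^sup>2 = a\<^sup>2 + 1"
  shows "1 / b ^ 3 \<le> 2 / a - 2 / b" "2 / a - 2 / b \<le> 1 / a ^ 3"
proof -
  have b: "0 < b" using assms by linarith
  have "(b - a) * (b + a) = 1" using assms(3) by (simp add: algebra_simps power2_eq_square)
  hence d: "b - a = 1 / (b + a)" using assms(1) b by (simp add: field_simps)
  \<comment> \<open>Both bounds follow from this form, since a b (a + b) lies between 2 a^3 and 2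
    b^3.\<close>
  have eq: "2 / a - 2 / b = 2 / (a * b * (a + b))"
  proof -
    have "2 / a - 2 / b = 2 * (b - a) / (a * b)" using assms(1) b by (simp add: field_simps)
    thus ?thesis using d by (simp add: field_simps)
  qed
  have "a * b * (a + b) \<le> b * b * (b + b)"
    using assms(1,2) b by (intro mult_mono add_mono) auto
  hence "2 / (b * b * (b + b)) \<le> 2 / (a * b * (a + b))"
    using assms(1) b by (intro divide_left_mono) auto
  thus "1 / b ^ 3 \<le> 2 / a - 2 / b" unfolding eq using b by (simp add: power3_eq_cube field_simps)
  have "a * a * (a + a) \<le> a * b * (a + b)"
    using assms(1,2) b by (intro mult_mono add_mono) auto
  hence "2 / (a * b * (a + b)) \<le> 2 / (a * a * (a + a))"
    using assms(1) b by (intro divide_left_mono) auto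
  thus "2 / a - 2 / b \<le> 1 / a ^ 3" unfolding eq using assms(1) by (simp add: power3_eq_cube field_simps)
qed

section \<open>Tails and summability of the interaction\<close>

lemma Jint_nonneg: "0 \<le> J1 \<Longrightarrow> 0 \<le> Jint J1 n"
  by (simp add: Jint_def)

text \<open>In the variable \<open>sqrt n\<close> the interaction is an inverse cube, and
  consecutive roots have squares differing by 1. So \<open>inverse_cube_bounds\<close> squeezes it
  between increments of -2 / sqrt, and sums of the interaction telescope.\<close>

lemma Jint_eq_cube:
  assumes "2 \<le> n"
  shows "Jint J1 n = 1 / sqrt (real n) ^ 3"
proof -
  have "real n powr (- 2 + rfi_alpha) = real n powr - (1/2 * 3)" by (simp add: rfi_alpha_def)
  also have "\<dots> = 1 / (real n powr (1/2)) powr 3"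
    unfolding powr_minus_divide powr_powr ..
  also have "\<dots> = 1 / sqrt (real n) powr real 3" by (simp add: powr_half_sqrt)
  also have "\<dots> = 1 / sqrt (real n) ^ 3"
    using assms by (subst powr_realpow) auto
  finally show ?thesis using assms by (simp add: Jint_def)
qed

lemma Jint_le:
  assumes "2 \<le> n"
  shows "Jint J1 n \<le> 2 / sqrt (real n - 1) - 2 / sqrt (real n)"
  using inverse_cube_bounds(1)[of "sqrt (real n - 1)" "sqrt (real n)"] assms
  by (simp add: Jint_eq_cube)

text \<open>The surplus \<open>J1 - 1\<close> of the nearest-neighbour coupling is kept as a
  separate summand, because it later pays the additive losses in
  \<open>flip_gain_isolated_run\<close>.\<close>

lemma Jint_ge:
  assumes "1 \<le> n"
  shows "2 / sqrt (real n) - 2 / sqrt (real n + 1) + (if n = 1 then J1 - 1 else 0) \<le> Jint J1 n"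
proof (cases "n = 1")
  case True
  have "1 \<le> 2 / sqrt 2" using real_sqrt_le_mono[of 2 4] by (simp add: field_simps)
  thus ?thesis using True by (simp add: Jint_def)
next
  case False
  thus ?thesis
    using inverse_cube_bounds(2)[of "sqrt (real n)" "sqrt (real n + 1)"] assms
    by (simp add: Jint_eq_cube)
qed

text \<open>For \<open>m = 1\<close> the first summand of the bound is \<open>2 / 0 = 0\<close>.\<close>
lemma sum_Jint_le:
  assumes "0 \<le> J1" "1 \<le> m" "finite F" "F \<subseteq> {m..}"
  shows "sum (Jint J1) F \<le> 2 / sqrt (real m - 1) + (if m = 1 then J1 + 2 else 0)"
proof -
  have *: "sum (Jint J1) F \<le> 2 / sqrt (real m - 1)" if "2 \<le> m" "finite F" "F \<subseteq> {m..}" for m F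
  proof -
    obtain K where K: "F \<subseteq> {..<K}" using \<open>finite F\<close> finite_nat_iff_bounded by blast
    let ?K = "max m K"
    have "sum (Jint J1) F \<le> sum (Jint J1) {m..<?K}"
    proof (rule sum_mono2)
      show "F \<subseteq> {m..<?K}" using K that(3) by (auto simp: subset_iff less_max_iff_disj)
    qed (use assms(1) in \<open>auto simp: Jint_nonneg\<close>)
    also have "\<dots> \<le> (\<Sum>n=m..<?K. 2 / sqrt (real n - 1) - 2 / sqrt (real (Suc n) - 1))"
      using that by (intro sum_mono) (use Jint_le in auto)
    also have "\<dots> = 2 / sqrt (real m - 1) - 2 / sqrt (real ?K - 1)"
      using sum_Suc_diff'[of m ?K "\<lambda>n. - (2 / sqrt (real n - 1))"] by simp
    also have "\<dots> \<le> 2 / sqrt (real m - 1)" using that by auto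
    finally show ?thesis .
  qed
  show ?thesis
  proof (cases "m = 1")
    case False
    thus ?thesis using *[of m F] assms by auto
  next
    case True
    have "sum (Jint J1) F \<le> sum (Jint J1) (insert 1 (F \<inter> {2..}))"
      using assms True by (intro sum_mono2) (auto simp: Jint_nonneg)
    also have "\<dots> = J1 + sum (Jint J1) (F \<inter> {2..})"
      using assms(3) by (subst sum.insert) (auto simp: Jint_def)
    also have "\<dots> \<le> J1 + 2" using *[of 2 "F \<inter> {2..}"] assms(3) by auto
    finally show ?thesis using True by simp
  qed
qed

lemma Jint_summable_nat:
  assumes "0 \<le> J1"
  shows "Jint J1 summable_on {1..}"
  using assms sum_Jint_le[OF assms order_refl]
  by (intro nonneg_bdd_above_summable_on bdd_aboveI[where M = "J1 + 2"])
     (auto simp: Jint_nonneg)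

lemma infsum_Jint_le:
  assumes "0 \<le> J1" "1 \<le> m"
  shows "infsum (Jint J1) {m..} \<le> 2 / sqrt (real m - 1) + (if m = 1 then J1 + 2 else 0)"
proof (rule infsum_le_finite_sums)
  show "Jint J1 summable_on {m..}"
    using Jint_summable_nat[OF assms(1)] by (rule summable_on_subset_banach) (use assms in auto)
qed (use sum_Jint_le[OF assms] in auto)

lemma bij_betw_right_half: "bij_betw (\<lambda>n. i + int n) {m..} {i + int m..}"
  by (rule bij_betwI[where g = "\<lambda>j. nat (j - i)"]) auto

lemma bij_betw_left_half: "bij_betw (\<lambda>n. i - int n) {m..} {..i - int m}"
  by (rule bij_betwI[where g = "\<lambda>j. nat (i - j)"]) auto

lemma Jint_summable_on:
  assumes "0 \<le> J1"
  shows "(\<lambda>j. Jint J1 (nat \<bar>i - j\<bar>)) summable_on B"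
proof -
  let ?f = "\<lambda>j. Jint J1 (nat \<bar>i - j\<bar>)"
  have "?f summable_on {i + int 1..}"
    using Jint_summable_nat[OF assms]
    by (subst summable_on_reindex_bij_betw[OF bij_betw_right_half, symmetric]) simp
  moreover have "?f summable_on {..i - int 1}"
    using Jint_summable_nat[OF assms]
    by (subst summable_on_reindex_bij_betw[OF bij_betw_left_half, symmetric]) simp
  moreover have "?f summable_on {i}" by simp
  ultimately have "?f summable_on ({i + int 1..} \<union> {..i - int 1} \<union> {i})"
    by (intro summable_on_Un_disjoint) auto
  thus ?thesis by (rule summable_on_subset_banach) auto
qed

text \<open>The complement is two half-lines at distances i - p + 1 and q - i, and a tail from
  distance m costs 2 / sqrt (m - 1). If i is an end of the interval, the square root vanishes, 2 / 0
  = 0, and J1 + 2 takes over.\<close>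

lemma infsum_Jint_outside_le:
  assumes "0 \<le> J1" "p \<le> i" "i < q"
  shows "infsum (\<lambda>j. Jint J1 (nat \<bar>i - j\<bar>)) (- {p..<q})
    \<le> 2 / sqrt (real_of_int (i - p)) + (if p = i then J1 + 2 else 0)
     + (2 / sqrt (real_of_int (q - 1 - i)) + (if q = i + 1 then J1 + 2 else 0))"
proof -
  let ?f = "\<lambda>j. Jint J1 (nat \<bar>i - j\<bar>)"
  define m where "m = nat (i - p + 1)"
  define k where "k = nat (q - i)"
  have sets: "- {p..<q} = {..i - int m} \<union> {i + int k..}" using assms by (auto simp: m_def k_def)
  have "infsum ?f (- {p..<q}) = infsum ?f {..i - int m} + infsum ?f {i + int k..}"
    unfolding sets using assms
    by (intro infsum_Un_disjoint Jint_summable_on) (auto simp: m_def k_def)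
  also have "infsum ?f {..i - int m} = infsum (Jint J1) {m..}"
    by (subst infsum_reindex_bij_betw[OF bij_betw_left_half, symmetric]) simp
  also have "infsum ?f {i + int k..} = infsum (Jint J1) {k..}"
    by (subst infsum_reindex_bij_betw[OF bij_betw_right_half, symmetric]) simp
  also have "infsum (Jint J1) {m..}
      \<le> 2 / sqrt (real_of_int (i - p)) + (if p = i then J1 + 2 else 0)"
  proof -
    have "real m - 1 = real_of_int (i - p)" "m = 1 \<longleftrightarrow> p = i" "1 \<le> m" using assms by (auto simp: m_def)
    thus ?thesis using infsum_Jint_le[OF assms(1), of m] by presburger
  qed
  also have "infsum (Jint J1) {k..}
      \<le> 2 / sqrt (real_of_int (q - 1 - i)) + (if q = i + 1 then J1 + 2 else 0)"
  proof -
    have "real k - 1 = real_of_int (q - 1 - i)" "k = 1 \<longleftrightarrow> q = i + 1" "1 \<le> k"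
      using assms by (auto simp: k_def)
    thus ?thesis using infsum_Jint_le[OF assms(1), of k] by presburger
  qed
  finally show ?thesis by simp
qed

section \<open>Energy of a flip and the resulting Gibbs estimate\<close>

definition flip_gain ::
  "real \<Rightarrow> real \<Rightarrow> (int \<Rightarrow> real) \<Rightarrow> int set \<Rightarrow> real \<Rightarrow> (int \<Rightarrow> real) \<Rightarrow> real" where
  "flip_gain J1 \<theta> h Lam s sig =
     2 * (\<Sum>i\<in>Lam. infsum (\<lambda>j. Jint J1 (nat \<bar>i - j\<bar>) * (- s * sig j)) (- Lam))
     - 2 * \<theta> * s * (\<Sum>i\<in>Lam. h i)"

lemma Jint_mult_summable_on:
  assumes "0 \<le> J1" "\<And>j. j \<in> B \<Longrightarrow> \<bar>g j\<bar> \<le> c"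
  shows "(\<lambda>j. Jint J1 (nat \<bar>i - j\<bar>) * g j) summable_on B"
proof -
  have "(\<lambda>j. norm (Jint J1 (nat \<bar>i - j\<bar>) * g j)) summable_on B"
  proof (rule Infinite_Sum.abs_summable_on_comparison_test')
    show "(\<lambda>j. Jint J1 (nat \<bar>i - j\<bar>) * c) summable_on B"
      by (intro summable_on_cmult_left Jint_summable_on assms)
  next
    fix j assume "j \<in> B"
    thus "norm (Jint J1 (nat \<bar>i - j\<bar>) * g j) \<le> Jint J1 (nat \<bar>i - j\<bar>) * c"
      using assms by (auto simp: abs_mult Jint_nonneg intro!: mult_left_mono)
  qed
  thus ?thesis using summable_on_iff_abs_summable_on_real by blast
qed

text \<open>Pairs inside \<open>Lam\<close> agree before and after the flip and contribute 0. A
  boundary factor changes from 1 - s sig j to 1 + s sig j, which gives the factor 2 in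
  \<open>flip_gain\<close>; the field term also changes sign.\<close>

lemma hamiltonian_flip:
  assumes J: "0 \<le> J1" and s: "s \<in> {-1, 1}"
    and "\<And>i. i \<in> Lam \<Longrightarrow> sig i = s" "\<And>i. i \<in> Lam \<Longrightarrow> sig' i = - s"
    and "\<And>i. i \<notin> Lam \<Longrightarrow> sig' i = sig i" "\<And>i. i \<notin> Lam \<Longrightarrow> sig i \<in> {-1, 1}"
  shows "hamiltonian J1 \<theta> h Lam sig - hamiltonian J1 \<theta> h Lam sig' = flip_gain J1 \<theta> h Lam s sig"
proof -
  let ?J = "\<lambda>i j. Jint J1 (nat \<bar>i - j\<bar>)"
  have ss: "s * s = 1" using s by auto
  have b: "\<bar>1 - s * sig j\<bar> \<le> 2" "\<bar>1 + s * sig j\<bar> \<le> 2" "\<bar>s * sig j\<bar> \<le> 2"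
    if "j \<in> - Lam" for j
    using assms(6)[of j] that s by auto
  have "infsum (\<lambda>j. ?J i j * (1 - s * sig j)) (- Lam)
      = infsum (\<lambda>j. ?J i j * (1 + s * sig j)) (- Lam)
        + 2 * infsum (\<lambda>j. ?J i j * (- s * sig j)) (- Lam)" for i
  proof -
    have "infsum (\<lambda>j. ?J i j * (1 - s * sig j)) (- Lam)
      = infsum (\<lambda>j. ?J i j * (1 + s * sig j) + ?J i j * (- s * sig j) * 2) (- Lam)"
      by (intro infsum_cong) (auto simp: algebra_simps)
    also have "\<dots> = infsum (\<lambda>j. ?J i j * (1 + s * sig j)) (- Lam)
        + infsum (\<lambda>j. ?J i j * (- s * sig j) * 2) (- Lam)"
      using b by (intro infsum_add Jint_mult_summable_on[OF J, where c=2] summable_on_cmult_left) auto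
    also have "infsum (\<lambda>j. ?J i j * (- s * sig j) * 2) (- Lam)
        = infsum (\<lambda>j. ?J i j * (- s * sig j)) (- Lam) * 2"
      using b by (intro infsum_cmult_left Jint_mult_summable_on[OF J, where c=2]) auto
    finally show ?thesis by simp
  qed
  note eq = this
  have "hamiltonian J1 \<theta> h Lam sig = - \<theta> * (s * (\<Sum>i\<in>Lam. h i))
     + (\<Sum>i\<in>Lam. infsum (\<lambda>j. ?J i j * (1 - s * sig j)) (- Lam))"
  proof -
    have "(\<Sum>i\<in>Lam. h i * sig i) = s * (\<Sum>i\<in>Lam. h i)"
      using assms(3) by (simp add: sum_distrib_left mult.commute)
    thus ?thesis unfolding hamiltonian_def using assms(3) by (simp add: ss)
  qed
  moreover have "hamiltonian J1 \<theta> h Lam sig' = \<theta> * (s * (\<Sum>i\<in>Lam. h i))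
     + (\<Sum>i\<in>Lam. infsum (\<lambda>j. ?J i j * (1 + s * sig j)) (- Lam))"
  proof -
    have "(\<Sum>i\<in>Lam. infsum (\<lambda>j. ?J i j * (1 - sig' i * sig' j)) (- Lam))
       = (\<Sum>i\<in>Lam. infsum (\<lambda>j. ?J i j * (1 + s * sig j)) (- Lam))"
      using assms(4,5) by (intro sum.cong infsum_cong refl) auto
    moreover have "(\<Sum>i\<in>Lam. h i * sig' i) = - (s * (\<Sum>i\<in>Lam. h i))"
      using assms(4) by (simp add: sum_distrib_left mult.commute sum_negf)
    ultimately show ?thesis unfolding hamiltonian_def using assms(4) by (simp add: ss)
  qed
  ultimately show ?thesis
    by (simp add: flip_gain_def eq sum.distrib flip: sum_distrib_left)
qed

lemma space_spin_space: "space spin_space = UNIV \<rightarrow> {-1, 1}"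
  by (auto simp: spin_space_def space_PiM)

text \<open>Being constant on \<open>Lam\<close> leaves a single summand in the numerator of the
  kernel, and the partition function is at least the weight of the flipped configuration. The ratio
  of these two weights is exp (- \<beta> * gain), uniformly in the boundary condition.\<close>

lemma flip_bound:
  assumes gibbs: "gibbs_measure J1 \<beta> \<theta> h \<mu>" and J: "0 \<le> J1" and "0 \<le> \<beta>"
    and fin: "finite Lam" and s: "s \<in> {-1, 1}" and A: "A \<in> sets spin_space"
    and const: "\<And>sig i. sig \<in> A \<Longrightarrow> i \<in> Lam \<Longrightarrow> sig i = s"
    and gain: "\<And>sig. sig \<in> A \<Longrightarrow> D \<le> flip_gain J1 \<theta> h Lam s sig"
  shows "measure \<mu> A \<le> exp (- \<beta> * D)"
proof -
  have P: "prob_space \<mu>" and sets: "sets \<mu> = sets spin_space"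
    and dlr: "measure \<mu> A = (\<integral>eta. gibbs_kernel J1 \<beta> \<theta> h Lam eta A \<partial>\<mu>)"
    using gibbs fin A by (auto simp: gibbs_measure_def)
  interpret prob_space \<mu> by fact
  have sp: "space \<mu> = UNIV \<rightarrow> {-1, 1}" using sets_eq_imp_space_eq[OF sets] space_spin_space by simp
  have "gibbs_kernel J1 \<beta> \<theta> h Lam eta A \<le> exp (- \<beta> * D)" if eta: "eta \<in> space \<mu>" for eta
  proof -
    let ?m = "\<lambda>tau. merge_conf Lam tau eta" and ?T = "\<Pi>\<^sub>E i\<in>Lam. {-1, 1::real}"
    let ?w = "\<lambda>tau. exp (- \<beta> * hamiltonian J1 \<theta> h Lam (?m tau))"
    let ?Z = "partition_fn J1 \<beta> \<theta> h Lam eta"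
    let ?p = "restrict (\<lambda>_. s) Lam" and ?n = "restrict (\<lambda>_. - s) Lam"
    have T: "finite ?T" using fin by (simp add: finite_PiE)
    have pT: "?p \<in> ?T" and nT: "?n \<in> ?T" using s by auto
    have "(\<Sum>tau\<in>?T. ?w tau * indicator A (?m tau)) = (\<Sum>tau\<in>{?p}. ?w tau * indicator A (?m tau))"
    proof (rule sum.mono_neutral_right[OF T])
      show "\<forall>tau\<in>?T - {?p}. ?w tau * indicator A (?m tau) = 0"
      proof
        fix tau assume tau: "tau \<in> ?T - {?p}"
        have "?m tau \<notin> A"
        proof
          assume "?m tau \<in> A"
          hence "tau i = s" if "i \<in> Lam" for i using const that by (force simp: merge_conf_def)
          hence "tau = ?p" using tau by (intro ext) (auto simp: PiE_def extensional_def)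
          thus False using tau by simp
        qed
        thus "?w tau * indicator A (?m tau) = 0" by simp
      qed
    qed (use pT in auto)
    hence K: "gibbs_kernel J1 \<beta> \<theta> h Lam eta A = ?w ?p * indicator A (?m ?p) / ?Z"
      unfolding gibbs_kernel_def by (subst (asm) sum.insert) (simp_all only: finite.emptyI sum.empty add_0_right empty_iff not_False_eq_True)
    show ?thesis
    proof (cases "?m ?p \<in> A")
      case False thus ?thesis unfolding K by simp
    next
      case True
      have "?w ?n \<le> ?Z" unfolding partition_fn_def
        by (rule member_le_sum[OF nT _ T]) simp
      hence "?w ?p / ?Z \<le> ?w ?p / ?w ?n"
        by (intro divide_left_mono mult_pos_pos less_le_trans[OF exp_gt_zero]) auto
      also have "\<dots> = exp (- \<beta> * (hamiltonian J1 \<theta> h Lam (?m ?p) - hamiltonian J1 \<theta> h Lam (?m ?n)))"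
        by (simp add: exp_diff[symmetric] algebra_simps)
      also have "hamiltonian J1 \<theta> h Lam (?m ?p) - hamiltonian J1 \<theta> h Lam (?m ?n)
          = flip_gain J1 \<theta> h Lam s (?m ?p)"
        using eta by (intro hamiltonian_flip J s) (auto simp: merge_conf_def sp)
      also have "exp (- \<beta> * \<dots>) \<le> exp (- \<beta> * D)"
        using gain[OF True] \<open>0 \<le> \<beta>\<close> by (simp add: mult_left_mono)
      finally show ?thesis unfolding K using True by (simp only: indicator_simps mult_1_right)
    qed
  qed
  note bound = this
  show ?thesis
  \<comment> \<open>A non-integrable function has Bochner integral 0, so in that case the Gibbs
    equation gives \<open>A\<close> measure 0. The case split takes the place of a measurability
    proof for the kernel.\<close>
  proof (cases "integrable \<mu> (\<lambda>eta. gibbs_kernel J1 \<beta> \<theta> h Lam eta A)")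
    case True
    hence "(\<integral>eta. gibbs_kernel J1 \<beta> \<theta> h Lam eta A \<partial>\<mu>) \<le> (\<integral>eta. exp (- \<beta> * D) \<partial>\<mu>)"
      by (intro integral_mono bound) auto
    thus ?thesis using dlr by (simp add: prob_space)
  next
    case False
    thus ?thesis using dlr by (simp add: not_integrable_integral_eq)
  qed
qed

section \<open>Energy gain of flipping an interval\<close>

text \<open>Each summand is compared with an increment of 2 sqrt, using (b - a) (b + a) = 1 for
  consecutive roots a and b. The next lemma is the matching lower bound, without the shift by
  1.\<close>

lemma sum_inverse_sqrt_le:
  fixes p :: real
  assumes "0 \<le> p"
  shows "(\<Sum>k<n. 1 / sqrt (p + real k + 1)) \<le> 2 * (sqrt (p + real n) - sqrt p)"
proof (induction n)
  case (Suc n)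
  define a where "a = sqrt (p + real n)"
  define b where "b = sqrt (p + real n + 1)"
  have "0 \<le> a" "0 < b" "a \<le> b" using assms by (auto simp: a_def b_def)
  moreover have "(b - a) * (b + a) = 1"
    using assms by (simp add: a_def b_def algebra_simps)
  ultimately have "1 \<le> (b - a) * (2 * b)"
    using mult_left_mono[of "b + a" "2 * b" "b - a"] by auto
  hence "1 / b \<le> 2 * (b - a)" using \<open>0 < b\<close> by (simp add: field_simps)
  thus ?case using Suc by (simp add: a_def b_def algebra_simps)
qed simp

lemma sum_inverse_sqrt_ge:
  fixes p :: real
  assumes "0 < p"
  shows "2 * (sqrt (p + real n) - sqrt p) \<le> (\<Sum>k<n. 1 / sqrt (p + real k))"
proof (induction n)
  case (Suc n)
  define a where "a = sqrt (p + real n)"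
  define b where "b = sqrt (p + real n + 1)"
  have "0 < a" "a \<le> b" using assms by (auto simp: a_def b_def)
  moreover have "(b - a) * (b + a) = 1"
    using assms by (simp add: a_def b_def algebra_simps)
  ultimately have "(b - a) * (2 * a) \<le> 1"
    using mult_left_mono[of "2 * a" "b + a" "b - a"] by auto
  hence "2 * (b - a) \<le> 1 / a" using \<open>0 < a\<close> by (simp add: field_simps)
  thus ?case using Suc by (simp add: a_def b_def algebra_simps)
qed simp

lemma sum_int_interval:
  "(\<Sum>i\<in>{a..<a + int d}. f i) = (\<Sum>k<d. f (a + int k))"
  by (rule sum.reindex_bij_witness[where i = "\<lambda>k. a + int k" and j = "\<lambda>i. nat (i - a)"]) auto

lemma sum_Jint_ge:
  assumes "1 \<le> m" "1 \<le> d"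
  shows "2 / sqrt (real m) - 2 / sqrt (real (m + d)) + (if m = 1 then J1 - 1 else 0)
    \<le> (\<Sum>l<d. Jint J1 (m + l))"
  using assms(2)
proof (induction d rule: dec_induct)
  case base
  thus ?case using Jint_ge[OF assms(1), of J1] by (simp add: add.commute)
next
  case (step d)
  have "2 / sqrt (real (m + d)) - 2 / sqrt (real (m + d) + 1) \<le> Jint J1 (m + d)"
    using Jint_ge[of "m + d" J1] assms(1) step(1) by simp
  thus ?case using step by (simp add: algebra_simps)
qed

text \<open>\<open>F\<close> is the part of the outside where the spins are known. Everywhere else
  the worst case is assumed, namely that the spin equals s and resists the flip with its full
  coupling.\<close>

lemma infsum_coupling_ge:
  assumes J: "0 \<le> J1" and s: "s \<in> {-1, 1}" and "finite F" "F \<inter> Lam = {}"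
    and sig: "\<And>j. sig j \<in> {-1, 1}"
  shows "(\<Sum>j\<in>F. Jint J1 (nat \<bar>i - j\<bar>) * (- s * sig j))
      - infsum (\<lambda>j. Jint J1 (nat \<bar>i - j\<bar>)) (- (Lam \<union> F))
    \<le> infsum (\<lambda>j. Jint J1 (nat \<bar>i - j\<bar>) * (- s * sig j)) (- Lam)"
proof -
  let ?J = "\<lambda>j. Jint J1 (nat \<bar>i - j\<bar>)"
  let ?g = "\<lambda>j. ?J j * (- s * sig j)"
  have b: "\<bar>- s * sig j\<bar> \<le> 1" for j using s sig[of j] by auto
  have summ: "?g summable_on B" for B
    by (rule Jint_mult_summable_on[OF J b])
  have "- infsum ?J (- (Lam \<union> F)) = infsum (\<lambda>j. - ?J j) (- (Lam \<union> F))"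
    by (simp add: infsum_uminus)
  also have "\<dots> \<le> infsum ?g (- (Lam \<union> F))"
  proof (rule infsum_mono)
    show "(\<lambda>j. - ?J j) summable_on - (Lam \<union> F)"
      by (intro summable_on_uminus[THEN iffD2] Jint_summable_on J)
    show "- ?J j \<le> ?g j" for j
      using mult_left_mono[of "-1" "- s * sig j" "?J j"] b[of j] Jint_nonneg[OF J] by (simp add: abs_le_iff)
  qed (rule summ)
  finally have "(\<Sum>j\<in>F. ?g j) - infsum ?J (- (Lam \<union> F)) \<le> infsum ?g F + infsum ?g (- (Lam \<union> F))"
    using \<open>finite F\<close> by simp
  also have "\<dots> = infsum ?g (F \<union> - (Lam \<union> F))"
    by (rule infsum_Un_disjoint[symmetric, OF summ summ]) auto
  also have "F \<union> - (Lam \<union> F) = - Lam" using assms(4) by auto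
  finally show ?thesis .
qed

text \<open>All outside spins are taken to be hostile (\<open>F\<close> empty in
  \<open>infsum_coupling_ge\<close>). A site at distance k from an end then loses about 2 / sqrt k,
  so the boundary costs order sqrt d plus J1, against a field energy linear in d.\<close>

lemma flip_gain_uniform_field:
  assumes J: "0 \<le> J1" and s: "s \<in> {-1, 1}" and d: "1 \<le> d" and sig: "\<And>j. sig j \<in> {-1, 1}"
    and h: "\<And>i. i \<in> {a..<a + int d} \<Longrightarrow> h i = - s"
  shows "2 * \<theta> * real d - 4 * J1 - 8 - 16 * sqrt (real d)
    \<le> flip_gain J1 \<theta> h {a..<a + int d} s sig"
proof -
  let ?L = "{a..<a + int d}"
  let ?e = "\<lambda>k. 2 / sqrt (real k) + (if k = 0 then J1 + 2 else 0)"
  have ss: "s * s = 1" using s by auto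
  have "(\<Sum>i\<in>?L. - (?e (nat (i - a)) + ?e (d - Suc (nat (i - a)))))
      \<le> (\<Sum>i\<in>?L. infsum (\<lambda>j. Jint J1 (nat \<bar>i - j\<bar>) * (- s * sig j)) (- ?L))"
  proof (rule sum_mono)
    fix i assume i: "i \<in> ?L"
    define k where "k = nat (i - a)"
    define k' where "k' = d - Suc k"
    have k: "i = a + int k" "d = Suc (k + k')" using i by (auto simp: k_def k'_def)
    have "infsum (\<lambda>j. Jint J1 (nat \<bar>i - j\<bar>)) (- ?L) \<le> ?e k + ?e k'"
      using infsum_Jint_outside_le[OF J, of a i "a + int d"] k by (simp split del: if_split)
    thus "- (?e (nat (i - a)) + ?e (d - Suc (nat (i - a))))
      \<le> infsum (\<lambda>j. Jint J1 (nat \<bar>i - j\<bar>) * (- s * sig j)) (- ?L)"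
      unfolding k_def[symmetric] k'_def[symmetric]
      using infsum_coupling_ge[OF J s, of "{}" ?L sig i] sig by (simp split del: if_split)
  qed
  also have "(\<Sum>i\<in>?L. - (?e (nat (i - a)) + ?e (d - Suc (nat (i - a)))))
      = - ((\<Sum>k<d. ?e k) + (\<Sum>k<d. ?e (d - Suc k)))"
    unfolding sum_int_interval by (simp only: sum_negf sum.distrib add_diff_cancel_left' nat_int)
  also have "\<dots> = - 2 * (\<Sum>k<d. ?e k)"
    unfolding sum.nat_diff_reindex[where g = ?e] by simp
  also have "(\<Sum>k<d. ?e k) = J1 + 2 + 2 * (\<Sum>k<d. 1 / sqrt (real k))"
  proof -
    have "(\<Sum>k<d. if k = 0 then J1 + 2 else 0) = J1 + 2" using d by (simp add: sum.delta)
    thus ?thesis by (simp only: sum.distrib sum_distrib_left) simp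
  qed
  finally have *: "- 2 * (J1 + 2 + 2 * (\<Sum>k<d. 1 / sqrt (real k)))
     \<le> (\<Sum>i\<in>?L. infsum (\<lambda>j. Jint J1 (nat \<bar>i - j\<bar>) * (- s * sig j)) (- ?L))" .
  \<comment> \<open>The term at k = 0 is 1 / 0 = 0, so the index can be shifted by one.\<close>
  have "(\<Sum>k<d. 1 / sqrt (real k)) = (\<Sum>k<d - 1. 1 / sqrt (0 + real k + 1))"
    using d sum.lessThan_Suc_shift[of "\<lambda>k. 1 / sqrt (real k)" "d - 1"] by (simp add: add.commute)
  also have "\<dots> \<le> 2 * sqrt (real d)"
    using sum_inverse_sqrt_le[of 0 "d - 1"] by (rule order_trans) auto
  finally have "(\<Sum>k<d. 1 / sqrt (real k)) \<le> 2 * sqrt (real d)" .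
  moreover have "s * (\<Sum>i\<in>?L. h i) = - real d"
  proof -
    have "(\<Sum>i\<in>?L. h i) = real d * (- s)" using h by (simp add: sum_int_interval)
    thus ?thesis using ss by (simp add: mult.left_commute)
  qed
  hence "2 * \<theta> * s * (\<Sum>i\<in>?L. h i) = - (2 * \<theta> * real d)" by (simp add: mult.assoc)
  ultimately show ?thesis using * by (simp add: flip_gain_def)
qed

text \<open>A run of length \<open>d\<close> between two runs of length at least \<open>d\<close> of the opposite sign interacts more
  strongly with these two than with everything beyond them: up to lower order terms, the difference
  is \<open>(12 - 8 \<surd>2) \<surd>d\<close> on each side.\<close>
lemma flip_gain_isolated_run:
  assumes J: "10 \<le> J1" and s: "s \<in> {-1, 1}" and d: "1 \<le> d" and sig: "\<And>j. sig j \<in> {-1, 1}"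
    and opp: "\<And>j. j \<in> {a - int d..<a} \<union> {a + int d..<a + 2 * int d} \<Longrightarrow> sig j = - s"
    and field: "\<theta> * \<bar>\<Sum>i\<in>{a..<a + int d}. h i\<bar> \<le> sqrt (real d)" and \<theta>: "0 \<le> \<theta>"
  shows "4 \<le> flip_gain J1 \<theta> h {a..<a + int d} s sig"
proof -
  let ?L = "{a..<a + int d}" and ?F = "{a - int d..<a} \<union> {a + int d..<a + 2 * int d}"
  \<comment> \<open>Lower bound for one side of a site at distance k from that end: the coupling to
    the d opposite spins next to the run, minus the tail beyond them, which starts at distance k + 1
    + d.\<close>
  let ?e = "\<lambda>k. 2 / sqrt (real (k + 1)) - 2 / sqrt (real (k + 1 + d)) + (if k = 0 then J1 - 1 else 0)
    - 2 / sqrt (real (k + d))"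
  have J0: "0 \<le> J1" using J by simp
  have ss: "s * s = 1" using s by auto
  have "(\<Sum>i\<in>?L. ?e (nat (i - a)) + ?e (d - Suc (nat (i - a))))
      \<le> (\<Sum>i\<in>?L. infsum (\<lambda>j. Jint J1 (nat \<bar>i - j\<bar>) * (- s * sig j)) (- ?L))"
  proof (rule sum_mono)
    fix i assume i: "i \<in> ?L"
    define k where "k = nat (i - a)"
    define k' where "k' = d - Suc k"
    have k: "i = a + int k" "k < d" "d = Suc (k + k')" using i by (auto simp: k_def k'_def)
    have "(\<Sum>j\<in>?F. Jint J1 (nat \<bar>i - j\<bar>) * (- s * sig j)) = (\<Sum>j\<in>?F. Jint J1 (nat \<bar>i - j\<bar>))"
      using opp by (intro sum.cong refl) (simp add: ss)
    also have "\<dots> = (\<Sum>j\<in>{a - int d..<a}. Jint J1 (nat \<bar>i - j\<bar>))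
        + (\<Sum>j\<in>{a + int d..<a + 2 * int d}. Jint J1 (nat \<bar>i - j\<bar>))"
      by (rule sum.union_disjoint) auto
    also have "(\<Sum>j\<in>{a - int d..<a}. Jint J1 (nat \<bar>i - j\<bar>)) = (\<Sum>l<d. Jint J1 (k + 1 + l))"
      by (rule sum.reindex_bij_witness[where i = "\<lambda>l. a - 1 - int l" and j = "\<lambda>j. nat (a - 1 - j)"])
         (auto simp: k(1) intro!: arg_cong[where f = "Jint J1"])
    also have "(\<Sum>j\<in>{a + int d..<a + 2 * int d}. Jint J1 (nat \<bar>i - j\<bar>)) = (\<Sum>l<d. Jint J1 (k' + 1 + l))"
      by (rule sum.reindex_bij_witness[where i = "\<lambda>l. a + int d + int l" and j = "\<lambda>j. nat (j - a - int d)"])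
         (auto simp: k(1,3) intro!: arg_cong[where f = "Jint J1"])
    finally have F: "(\<Sum>j\<in>?F. Jint J1 (nat \<bar>i - j\<bar>) * (- s * sig j))
       = (\<Sum>l<d. Jint J1 (k + 1 + l)) + (\<Sum>l<d. Jint J1 (k' + 1 + l))" .
    have "?L \<union> ?F = {a - int d..<a + 2 * int d}" by auto
    hence "infsum (\<lambda>j. Jint J1 (nat \<bar>i - j\<bar>)) (- (?L \<union> ?F))
        \<le> 2 / sqrt (real (k + d)) + 2 / sqrt (real (k' + d))"
      using infsum_Jint_outside_le[OF J0, of "a - int d" i "a + 2 * int d"] k by (simp add: algebra_simps)
    moreover have "(\<Sum>j\<in>?F. Jint J1 (nat \<bar>i - j\<bar>) * (- s * sig j))
      - infsum (\<lambda>j. Jint J1 (nat \<bar>i - j\<bar>)) (- (?L \<union> ?F))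
      \<le> infsum (\<lambda>j. Jint J1 (nat \<bar>i - j\<bar>) * (- s * sig j)) (- ?L)"
      by (rule infsum_coupling_ge[OF J0 s]) (use sig in auto)
    moreover have "2 / sqrt (real (k + 1)) - 2 / sqrt (real (k + 1 + d)) + (if k = 0 then J1 - 1 else 0)
      \<le> (\<Sum>l<d. Jint J1 (k + 1 + l))"
      using sum_Jint_ge[of "k + 1" d J1] d by (simp split del: if_split)
    moreover have "2 / sqrt (real (k' + 1)) - 2 / sqrt (real (k' + 1 + d)) + (if k' = 0 then J1 - 1 else 0)
      \<le> (\<Sum>l<d. Jint J1 (k' + 1 + l))"
      using sum_Jint_ge[of "k' + 1" d J1] d by (simp split del: if_split)
    ultimately show "?e (nat (i - a)) + ?e (d - Suc (nat (i - a)))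
      \<le> infsum (\<lambda>j. Jint J1 (nat \<bar>i - j\<bar>) * (- s * sig j)) (- ?L)"
      unfolding k_def[symmetric] k'_def[symmetric] F by linarith
  qed
  also have "(\<Sum>i\<in>?L. ?e (nat (i - a)) + ?e (d - Suc (nat (i - a))))
      = (\<Sum>k<d. ?e k) + (\<Sum>k<d. ?e (d - Suc k))"
    unfolding sum_int_interval by (simp only: sum.distrib add_diff_cancel_left' nat_int)
  also have "\<dots> = 2 * (\<Sum>k<d. ?e k)"
    unfolding sum.nat_diff_reindex[where g = ?e] by simp
  also have "(\<Sum>k<d. ?e k) = 2 * (\<Sum>k<d. 1 / sqrt (1 + real k))
     - 2 * (\<Sum>k<d. 1 / sqrt (real d + real k + 1)) + (J1 - 1)
     - 2 * (\<Sum>k<d. 1 / sqrt ((real d - 1) + real k + 1))"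
  proof -
    have "(\<Sum>k<d. if k = 0 then J1 - 1 else 0) = J1 - 1" using d by (simp add: sum.delta)
    thus ?thesis by (simp only: sum.distrib sum_subtractf sum_distrib_left) (simp add: add_ac)
  qed
  finally have *: "2 * (2 * (\<Sum>k<d. 1 / sqrt (1 + real k))
     - 2 * (\<Sum>k<d. 1 / sqrt (real d + real k + 1)) + (J1 - 1)
     - 2 * (\<Sum>k<d. 1 / sqrt ((real d - 1) + real k + 1)))
     \<le> (\<Sum>i\<in>?L. infsum (\<lambda>j. Jint J1 (nat \<bar>i - j\<bar>) * (- s * sig j)) (- ?L))" .
  have "2 * (sqrt (1 + real d) - 1) \<le> (\<Sum>k<d. 1 / sqrt (1 + real k))"
    using sum_inverse_sqrt_ge[of 1 d] by simp
  moreover have "sqrt (real d) \<le> sqrt (1 + real d)" by simp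
  moreover have "(\<Sum>k<d. 1 / sqrt (real d + real k + 1)) \<le> 2 * (sqrt (2 * real d) - sqrt (real d))"
    using sum_inverse_sqrt_le[of "real d" d] by simp
  moreover have "(\<Sum>k<d. 1 / sqrt ((real d - 1) + real k + 1)) \<le> 2 * (sqrt (real d - 1 + real d) - sqrt (real d - 1))"
    using sum_inverse_sqrt_le[of "real d - 1" d] d by simp
  moreover have "sqrt (real d - 1 + real d) \<le> sqrt (2 * real d)" by simp
  moreover have "sqrt (real d) \<le> sqrt (real d - 1) + 1"
  proof -
    have "sqrt ((real d - 1) + 1) \<le> sqrt (real d - 1) + sqrt 1"
      using d by (intro sqrt_add_le_add_sqrt) auto
    thus ?thesis by simp
  qed
  \<comment> \<open>The approximation 1.43 of sqrt 2 is fine enough: 4 (12 - 8 * 1.43) = 2.24 still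
    exceeds the coefficient 2 of the field term.\<close>
  moreover have "sqrt (2 * real d) \<le> 143 / 100 * sqrt (real d)"
    unfolding real_sqrt_mult by (intro mult_right_mono real_le_lsqrt) (auto simp: power2_eq_square)
  moreover have "2 * \<theta> * s * (\<Sum>i\<in>?L. h i) \<le> 2 * sqrt (real d)"
  proof -
    have "\<theta> * (s * (\<Sum>i\<in>?L. h i)) \<le> \<theta> * \<bar>\<Sum>i\<in>?L. h i\<bar>"
      using s \<theta> by (intro mult_left_mono) auto
    thus ?thesis using field by (simp add: mult_ac)
  qed
  moreover have "1 \<le> sqrt (real d)" using d by simp
  \<comment> \<open>The integral comparisons lose 4 + 4 per side, against the surplus J1 - 1. With
    two sides and the factor 2 of the gain, 4 (J1 - 9) remains; this is where the threshold 10 for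
    J1 and the gain 4 come from.\<close>
  moreover have "4 \<le> 2 * S - T"
    if "2 * (u - 1) \<le> A" "v \<le> u" "B \<le> 2 * (w - v)" "C \<le> 2 * (w' - v')" "w' \<le> w" "v \<le> v' + 1"
      "w \<le> 143 / 100 * v" "T \<le> 2 * v" "1 \<le> v" "2 * (2 * A - 2 * B + (J1 - 1) - 2 * C) \<le> S"
    for u v w v' w' A B C S T :: real
  proof -
    have "4 * v - 4 \<le> 2 * A" "2 * B \<le> 4 * w - 4 * v" "2 * C \<le> 4 * w - 4 * v + 4"
      using that(1-6) by argo+
    hence "2 * (12 * v - 8 * w + 1) \<le> S" using that(10) J by argo
    thus ?thesis using that(7,8,9) by argo
  qed
  ultimately show ?thesis unfolding flip_gain_def using * by blast
qed

text \<open>Moving an isolated wall from \<open>x\<close> to \<open>y\<close>: inside \<open>{-R..<R}\<close> the interaction energy does not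
  increase by reflection symmetry, and the rest of the line acts on \<open>{x..<y}\<close> with bounded force.\<close>
lemma flip_gain_move_wall:
  assumes J: "0 \<le> J1" and s: "s \<in> {-1, 1}" and sig: "\<And>j. sig j \<in> {-1, 1}"
    and xy: "x < y" "0 \<le> x + y" "(y - x)\<^sup>2 \<le> R - y" "(y - x)\<^sup>2 \<le> R + x"
    and left: "\<And>j. j \<in> {- R..<x} \<Longrightarrow> sig j = - s"
    and right: "\<And>j. j \<in> {y..<R} \<Longrightarrow> sig j = s"
    and field: "6 \<le> - \<theta> * (s * (\<Sum>i\<in>{x..<y}. h i))"
  shows "4 \<le> flip_gain J1 \<theta> h {x..<y} s sig"
proof -
  let ?L = "{x..<y}" and ?F = "{- R..<x} \<union> {y..<R}"
  let ?J = "\<lambda>i j. Jint J1 (nat \<bar>i - j\<bar>)"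
  have ss: "s * s = 1" using s by auto
  have pos: "1 \<le> (y - x)\<^sup>2" using xy(1) by (intro one_le_power) simp
  hence R: "y \<le> R" "- R \<le> x" using xy by linarith+
  have "(\<Sum>i\<in>?L. (\<Sum>j\<in>{- R..<x}. ?J i j) - (\<Sum>j\<in>{y..<R}. ?J i j) - 4 / real_of_int (y - x))
      \<le> (\<Sum>i\<in>?L. infsum (\<lambda>j. ?J i j * (- s * sig j)) (- ?L))"
  proof (rule sum_mono)
    fix i assume i: "i \<in> ?L"
    have "(\<Sum>j\<in>?F. ?J i j * (- s * sig j))
       = (\<Sum>j\<in>{- R..<x}. ?J i j * (- s * sig j)) + (\<Sum>j\<in>{y..<R}. ?J i j * (- s * sig j))"
      using xy(1) by (intro sum.union_disjoint) auto
    also have "(\<Sum>j\<in>{- R..<x}. ?J i j * (- s * sig j)) = (\<Sum>j\<in>{- R..<x}. ?J i j)"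
      using left by (intro sum.cong refl) (simp add: ss)
    also have "(\<Sum>j\<in>{y..<R}. ?J i j * (- s * sig j)) = - (\<Sum>j\<in>{y..<R}. ?J i j)"
      unfolding sum_negf[symmetric] using right by (intro sum.cong refl) (simp add: ss)
    finally have F: "(\<Sum>j\<in>?F. ?J i j * (- s * sig j))
      = (\<Sum>j\<in>{- R..<x}. ?J i j) + - (\<Sum>j\<in>{y..<R}. ?J i j)" .
    \<comment> \<open>Room (y - x)^2 on each side makes the force from beyond the window at most 4 /
      (y - x) per site, hence at most 4 on the whole stretch.\<close>
    have inv: "2 / sqrt (real_of_int z) \<le> 2 / real_of_int (y - x)" if "(y - x)\<^sup>2 \<le> z" for z
    proof (rule divide_left_mono)
      have "real_of_int (y - x) = sqrt ((real_of_int (y - x))\<^sup>2)" using xy(1) by simp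
      also have "\<dots> \<le> sqrt (real_of_int z)"
        using that by (intro real_sqrt_le_mono) (metis of_int_le_iff of_int_power)
      finally show "real_of_int (y - x) \<le> sqrt (real_of_int z)" .
      thus "0 < sqrt (real_of_int z) * real_of_int (y - x)" using xy(1)
        by (intro mult_pos_pos) linarith+
    qed simp
    have "?L \<union> ?F = {- R..<R}" using R xy(1) by auto
    moreover have "infsum (?J i) (- {- R..<R})
        \<le> 2 / sqrt (real_of_int (i - (- R))) + 2 / sqrt (real_of_int (R - 1 - i))"
    proof -
      have "- R \<le> i" "i < R" "- R \<noteq> i" "R \<noteq> i + 1"
        using i R pos xy(3,4) unfolding atLeastLessThan_iff by linarith+
      thus ?thesis using infsum_Jint_outside_le[OF J, of "- R" i R] by simp
    qed
    moreover have "2 / sqrt (real_of_int (i - (- R))) \<le> 2 / real_of_int (y - x)"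
      "2 / sqrt (real_of_int (R - 1 - i)) \<le> 2 / real_of_int (y - x)"
      using xy(3,4) i by (intro inv; simp)+
    ultimately have "infsum (?J i) (- (?L \<union> ?F)) \<le> 4 / real_of_int (y - x)" by simp
    moreover have "(\<Sum>j\<in>?F. ?J i j * (- s * sig j)) - infsum (?J i) (- (?L \<union> ?F))
      \<le> infsum (\<lambda>j. ?J i j * (- s * sig j)) (- ?L)"
      by (rule infsum_coupling_ge[OF J s]) (use sig in auto)
    ultimately show "(\<Sum>j\<in>{- R..<x}. ?J i j) - (\<Sum>j\<in>{y..<R}. ?J i j) - 4 / real_of_int (y - x)
      \<le> infsum (\<lambda>j. ?J i j * (- s * sig j)) (- ?L)"
      unfolding F by linarith
  qed
  also have "(\<Sum>i\<in>?L. (\<Sum>j\<in>{- R..<x}. ?J i j) - (\<Sum>j\<in>{y..<R}. ?J i j) - 4 / real_of_int (y - x))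
    = (\<Sum>i\<in>?L. \<Sum>j\<in>{- R..<x}. ?J i j) - (\<Sum>i\<in>?L. \<Sum>j\<in>{y..<R}. ?J i j) - 4"
    using xy(1) by (simp add: sum_subtractf del: of_int_diff)
  \<comment> \<open>The reflection i |-> x + y - 1 - i preserves {x..<y} and maps {y..<R} onto {x +
    y - R..<x}. Since 0 <= x + y, this lies inside {- R..<x}: the attraction from the left is at
    least that from the right.\<close>
  also have "(\<Sum>i\<in>?L. \<Sum>j\<in>{y..<R}. ?J i j) = (\<Sum>i\<in>?L. \<Sum>j\<in>{x + y - R..<x}. ?J i j)"
    by (rule sum.reindex_bij_witness[where i = "\<lambda>i. x + y - 1 - i" and j = "\<lambda>i. x + y - 1 - i"])
       (auto intro!: sum.reindex_bij_witness[where i = "\<lambda>i. x + y - 1 - i" and j = "\<lambda>i. x + y - 1 - i"]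
          arg_cong[where f = "Jint J1"])
  finally have "(\<Sum>i\<in>?L. \<Sum>j\<in>{- R..<x}. ?J i j) - (\<Sum>i\<in>?L. \<Sum>j\<in>{x + y - R..<x}. ?J i j) - 4
    \<le> (\<Sum>i\<in>?L. infsum (\<lambda>j. ?J i j * (- s * sig j)) (- ?L))" .
  moreover have "(\<Sum>i\<in>?L. \<Sum>j\<in>{x + y - R..<x}. ?J i j) \<le> (\<Sum>i\<in>?L. \<Sum>j\<in>{- R..<x}. ?J i j)"
    using xy(2) by (intro sum_mono sum_mono2) (auto simp: Jint_nonneg[OF J])
  \<comment> \<open>The field contributes at least 6 and the far field takes at most 4; doubling the
    difference gives 4.\<close>
  ultimately show ?thesis using field unfolding flip_gain_def by (simp add: algebra_simps)
qed

section \<open>Runs of Gibbs configurations\<close>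

definition isolated_run :: "(int \<Rightarrow> real) \<Rightarrow> int \<Rightarrow> nat \<Rightarrow> real \<Rightarrow> bool" where
  "isolated_run sig a d s \<longleftrightarrow> (\<forall>i\<in>{a..<a + int d}. sig i = s) \<and>
     (\<forall>i\<in>{a - int d..<a} \<union> {a + int d..<a + 2 * int d}. sig i = - s)"

lemma interval_last:
  fixes j :: int
  assumes "j \<in> {a..<b}" "P j"
  shows "\<exists>m. a \<le> m \<and> m < b \<and> P m \<and> (\<forall>i. m < i \<longrightarrow> i < b \<longrightarrow> \<not> P i)"
proof -
  let ?S = "{a..<b} \<inter> Collect P"
  have "finite ?S" "?S \<noteq> {}" using assms by auto
  then obtain m where "m \<in> ?S" "\<And>i. i \<in> ?S \<Longrightarrow> i \<le> m" using Max_in Max_ge by metis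
  moreover from this have "\<not> P i" if "m < i" "i < b" for i
    using that by (metis IntI atLeastLessThan_iff Int_iff le_less_trans less_imp_le mem_Collect_eq not_le)
  ultimately show ?thesis by (intro exI[of _ m]) auto
qed

lemma interval_first:
  fixes j :: int
  assumes "j \<in> {a..<b}" "P j"
  shows "\<exists>m. a \<le> m \<and> m < b \<and> P m \<and> (\<forall>i. a \<le> i \<longrightarrow> i < m \<longrightarrow> \<not> P i)"
proof -
  let ?S = "{a..<b} \<inter> Collect P"
  have "finite ?S" "?S \<noteq> {}" using assms by auto
  then obtain m where "m \<in> ?S" "\<And>i. i \<in> ?S \<Longrightarrow> m \<le> i" using Min_in Min_le by metis
  thus ?thesis by (intro exI[of _ m]) force
qed

text \<open>A run that is not isolated has a strictly shorter neighbour; the descent ends within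
  distance \<open>d\<^sup>2\<close>.\<close>
lemma no_short_run:
  assumes sig: "\<And>j. sig j \<in> {-1, 1::real}"
    and no: "\<And>a d s. 1 \<le> d \<Longrightarrow> - N \<le> a \<Longrightarrow> a + int d \<le> N \<Longrightarrow> s \<in> {-1, 1} \<Longrightarrow> \<not> isolated_run sig a d s"
  shows "1 \<le> d \<Longrightarrow> - N \<le> a - (int d)\<^sup>2 \<Longrightarrow> a + int d + (int d)\<^sup>2 \<le> N \<Longrightarrow> s \<in> {-1, 1} \<Longrightarrow>
    \<forall>i\<in>{a..<a + int d}. sig i = s \<Longrightarrow> sig (a - 1) = - s \<Longrightarrow> sig (a + int d) = - s \<Longrightarrow> False"
proof (induction d arbitrary: a s rule: less_induct)
  case (less d)
  have sq: "0 \<le> (int d)\<^sup>2" by simp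
  \<comment> \<open>The next run in the descent is adjacent and has length d' < d, so the position
    moves by d'. The inequality says that this shift and the new reserve d'^2 both fit into the old
    reserve d^2.\<close>
  have sq': "int d' + (int d')\<^sup>2 \<le> (int d)\<^sup>2" if "d' < d" for d'
  proof -
    have "int d' * (1 + int d') \<le> int d * int d" using that by (intro mult_mono) auto
    thus ?thesis by (simp add: power2_eq_square algebra_simps)
  qed
  have neg: "sig j = - s" if "sig j \<noteq> s" for j using sig[of j] less.prems(4) that by auto
  have "s \<noteq> - s" using less.prems(4) by auto
  have "\<not> isolated_run sig a d s" using less.prems(1-4) sq by (intro no) linarith+
  then obtain j where j: "j \<in> {a - int d..<a} \<union> {a + int d..<a + 2 * int d}" "sig j = s"
    using less.prems(5) neg unfolding isolated_run_def by metis
  from j(1) show False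
  proof
    \<comment> \<open>A site of sign s within distance d to the left ends the neighbouring run of
      sign - s after fewer than d sites; m is the nearest such site.\<close>
    assume jl: "j \<in> {a - int d..<a}"
    obtain m where m: "a - int d \<le> m" "m < a" "sig m = s" "\<And>i. m < i \<Longrightarrow> i < a \<Longrightarrow> sig i \<noteq> s"
      using interval_last[of j "a - int d" a "\<lambda>i. sig i = s"] jl j(2) by blast
    have "m \<noteq> a - 1" using m less.prems(6) \<open>s \<noteq> - s\<close> by auto
    define d' where "d' = nat (a - 1 - m)"
    have d': "int d' = a - 1 - m" "1 \<le> d'" "d' < d" using m \<open>m \<noteq> a - 1\<close> by (auto simp: d'_def)
    show False
    proof (rule less.IH[of d' "m + 1" "- s"])
      show "\<forall>i\<in>{m + 1..<m + 1 + int d'}. sig i = - s"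
        using m(4) neg by (simp add: d'(1))
      show "sig (m + 1 + int d') = - (- s)" using less.prems(1,5) by (auto simp: d'(1))
      show "- N \<le> m + 1 - (int d')\<^sup>2" using less.prems(2) sq'[OF d'(3)] d'(1) by linarith
      show "m + 1 + int d' + (int d')\<^sup>2 \<le> N" using less.prems(3) sq'[OF d'(3)] d'(1) by linarith
    qed (use d' m less.prems in auto)
  next
    assume jr: "j \<in> {a + int d..<a + 2 * int d}"
    obtain m where m: "a + int d \<le> m" "m < a + 2 * int d" "sig m = s"
      "\<And>i. a + int d \<le> i \<Longrightarrow> i < m \<Longrightarrow> sig i \<noteq> s"
      using interval_first[of j "a + int d" "a + 2 * int d" "\<lambda>i. sig i = s"] jr j(2) by blast
    have "m \<noteq> a + int d" using m less.prems(7) \<open>s \<noteq> - s\<close> by auto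
    define d' where "d' = nat (m - a - int d)"
    have d': "int d' = m - a - int d" "1 \<le> d'" "d' < d" using m \<open>m \<noteq> a + int d\<close> by (auto simp: d'_def)
    show False
    proof (rule less.IH[of d' "a + int d" "- s"])
      show "\<forall>i\<in>{a + int d..<a + int d + int d'}. sig i = - s"
        using m(4) neg by (simp add: d'(1))
      show "sig (a + int d + int d') = - (- s)" using m by (simp add: d'(1))
      show "sig (a + int d - 1) = - (- s)" using less.prems(1,5) by auto
      show "- N \<le> a + int d - (int d')\<^sup>2" using less.prems(2) sq'[OF d'(3)] d'(1) by linarith
      show "a + int d + int d' + (int d')\<^sup>2 \<le> N" using less.prems(3) sq'[OF d'(3)] d'(1) by linarith
    qed (use d' m less.prems in auto)
  qed
qed

text \<open>A second sign change in {- R..<R} would enclose, together with the wall at x, a complete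
  run of length at most 2 R. \<open>no_short_run\<close> excludes it, since the room (2 R)^2 for the
  descent is available inside {- N..N}.\<close>

lemma single_wall:
  assumes sig: "\<And>j. sig j \<in> {-1, 1::real}"
    and no: "\<And>a d s. 1 \<le> d \<Longrightarrow> - N \<le> a \<Longrightarrow> a + int d \<le> N \<Longrightarrow> s \<in> {-1, 1} \<Longrightarrow> \<not> isolated_run sig a d s"
    and R: "R + (2 * R)\<^sup>2 \<le> N" and x: "- R < x" "x < R" "sig (x - 1) \<noteq> sig x"
  shows "\<forall>j\<in>{x..<R}. sig j = sig x" "\<forall>j\<in>{- R..<x}. sig j = - sig x"
proof -
  define s where "s = sig x"
  have s: "s \<in> {-1, 1}" unfolding s_def by (rule sig)
  have neg: "sig j = - s" if "sig j \<noteq> s" for j using sig[of j] s that by auto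
  have no_run: False if "1 \<le> d" "- R \<le> a" "a + int d \<le> R" "s \<in> {-1, 1}" "\<forall>i\<in>{a..<a + int d}. sig i = s"
    "sig (a - 1) = - s" "sig (a + int d) = - s" for a d s
  proof (rule no_short_run[OF sig no, where d = d and a = a and s = s])
    have "(int d)\<^sup>2 \<le> (2 * R)\<^sup>2" using that(2,3) by (intro power_mono) auto
    thus "- N \<le> a - (int d)\<^sup>2" "a + int d + (int d)\<^sup>2 \<le> N" using that(2,3) R by linarith+
  qed (use that in auto)
  show "\<forall>j\<in>{x..<R}. sig j = sig x"
    unfolding s_def[symmetric]
  proof (rule ccontr)
    assume "\<not> (\<forall>j\<in>{x..<R}. sig j = s)"
    then obtain j where j: "j \<in> {x..<R}" "sig j \<noteq> s" by blast
    from interval_first[of j x R "\<lambda>j. sig j \<noteq> s", OF j] obtain m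
      where m: "x \<le> m" "m < R" "sig m \<noteq> s" "\<forall>i. x \<le> i \<longrightarrow> i < m \<longrightarrow> \<not> sig i \<noteq> s"
      by (elim exE conjE)
    have "x \<noteq> m" using m(3) s_def by auto
    hence d: "x + int (nat (m - x)) = m" using m by auto
    show False
    proof (rule no_run[of "nat (m - x)" x "s"])
      show "\<forall>i\<in>{x..<x + int (nat (m - x))}. sig i = s" unfolding d using m(4) by auto
      show "sig (x + int (nat (m - x))) = - s" unfolding d using m(3) by (rule neg)
      show "sig (x - 1) = - s" using x(3) by (intro neg) (simp add: s_def)
    qed (use d m(1,2) x(1,2) s \<open>x \<noteq> m\<close> in auto)
  qed
  show "\<forall>j\<in>{- R..<x}. sig j = - sig x"
    unfolding s_def[symmetric]
  proof (rule ccontr)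
    assume "\<not> (\<forall>j\<in>{- R..<x}. sig j = - s)"
    then obtain j where j: "j \<in> {- R..<x}" "sig j = s" using neg by blast
    from interval_last[of j "- R" x "\<lambda>j. sig j = s", OF j] obtain m
      where m: "- R \<le> m" "m < x" "sig m = s" "\<forall>i. m < i \<longrightarrow> i < x \<longrightarrow> sig i \<noteq> s"
      by (elim exE conjE)
    have "x - 1 \<noteq> m" using m(3) x(3) by (auto simp: s_def)
    hence d: "m + 1 + int (nat (x - 1 - m)) = x" using m by auto
    show False
    proof (rule no_run[of "nat (x - 1 - m)" "m + 1" "- s"])
      show "\<forall>i\<in>{m + 1..<m + 1 + int (nat (x - 1 - m))}. sig i = - s"
        unfolding d using m(4) neg by simp
      show "sig (m + 1 + int (nat (x - 1 - m))) = - (- s)" unfolding d by (simp add: s_def)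
      show "- s \<in> {-1, 1}" using s by auto
    qed (use d m(1-3) x(1,2) \<open>x - 1 \<noteq> m\<close> in auto)
  qed
qed

section \<open>Measurability of cylinder and run events\<close>

lemma sets_spin_coordinate: "{sig \<in> space spin_space. sig i = c} \<in> sets spin_space"
proof -
  have "(\<lambda>sig. sig i) \<in> measurable spin_space (count_space {-1, 1})"
    unfolding spin_space_def by (rule measurable_component_singleton) simp
  hence "(\<lambda>sig. sig i) -` ({c} \<inter> {-1, 1}) \<inter> space spin_space \<in> sets spin_space"
    by (rule measurable_sets) auto
  also have "(\<lambda>sig. sig i) -` ({c} \<inter> {-1, 1}) \<inter> space spin_space = {sig \<in> space spin_space. sig i = c}"
    by (auto simp: space_spin_space Pi_iff)
  finally show ?thesis .
qed

lemma sets_spin_cylinder: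
  "finite F \<Longrightarrow> {sig \<in> space spin_space. \<forall>i\<in>F. sig i = g i} \<in> sets spin_space"
  by (intro sets.sets_Collect_finite_All sets_spin_coordinate)

text \<open>There are only countably many finite sets of integers, and each event
  \<open>run0 sig = K\<close> is a countable intersection of cylinder conditions. Restricting to
  finite runs therefore allows an arbitrary predicate \<open>Q\<close>.\<close>

lemma sets_run0: "{sig \<in> space spin_space. Q (run0 sig) \<and> finite (run0 sig)} \<in> sets spin_space"
proof -
  have eq: "{sig \<in> space spin_space. sig k = sig 0} \<in> sets spin_space" for k
  proof -
    have "{sig \<in> space spin_space. sig k = sig 0}
      = {sig \<in> space spin_space. (sig k = 1 \<and> sig 0 = 1) \<or> (sig k = -1 \<and> sig 0 = -1)}"
      by (auto simp: space_spin_space Pi_iff)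
    also have "\<dots> \<in> sets spin_space"
      by (intro sets.sets_Collect_disj sets.sets_Collect_conj sets_spin_coordinate)
    finally show ?thesis .
  qed
  have mem: "{sig \<in> space spin_space. i \<in> run0 sig} \<in> sets spin_space" for i
  proof -
    have "i \<in> run0 sig \<longleftrightarrow> (\<forall>k\<in>{min 0 i..max 0 i}. sig k = sig 0)" for sig
      unfolding run0_def mem_Collect_eq Ball_def atLeastAtMost_iff ..
    hence "{sig \<in> space spin_space. i \<in> run0 sig}
       = {sig \<in> space spin_space. \<forall>k\<in>{min 0 i..max 0 i}. sig k = sig 0}" by simp
    also have "\<dots> \<in> sets spin_space" by (intro sets.sets_Collect_finite_All eq) auto
    finally show ?thesis .
  qed
  have "{sig \<in> space spin_space. Q (run0 sig) \<and> finite (run0 sig)}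
     = (\<Union>K\<in>{K. finite K \<and> Q K}. {sig \<in> space spin_space. run0 sig = K})" by auto
  also have "\<dots> \<in> sets spin_space"
  proof (rule sets.countable_UN')
    show "countable {K :: int set. finite K \<and> Q K}"
      by (rule countable_subset[OF _ countable_Collect_finite]) auto
    show "(\<lambda>K. {sig \<in> space spin_space. run0 sig = K}) ` {K. finite K \<and> Q K} \<subseteq> sets spin_space"
    proof safe
      fix K :: "int set"
      have "{sig \<in> space spin_space. run0 sig = K}
        = {sig \<in> space spin_space. \<forall>i. i \<in> run0 sig \<longleftrightarrow> i \<in> K}"
        by (simp add: set_eq_iff)
      also have "\<dots> \<in> sets spin_space"
      proof (intro sets.sets_Collect_countable_All)
        show "{sig \<in> space spin_space. i \<in> run0 sig \<longleftrightarrow> i \<in> K} \<in> sets spin_space" for i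
          by (cases "i \<in> K") (simp_all add: mem sets.sets_Collect_neg)
      qed
      finally show "{sig \<in> space spin_space. run0 sig = K} \<in> sets spin_space" .
    qed
  qed
  finally show ?thesis .
qed

text \<open>The interface between probability and statistical mechanics: the clauses supply the
  field hypotheses of \<open>flip_gain_isolated_run\<close>, \<open>flip_gain_move_wall\<close> and
  \<open>flip_gain_uniform_field\<close>, the last on each side of the origin. In the second clause
  the target y may depend on both the wall position x and the sign s to its right.\<close>

definition good_field :: "real \<Rightarrow> int \<Rightarrow> int \<Rightarrow> int \<Rightarrow> nat \<Rightarrow> int \<Rightarrow> (int \<Rightarrow> real) \<Rightarrow> bool" where
  "good_field \<theta> M R N l Q h \<longleftrightarrow>
     (\<forall>a d. 1 \<le> d \<longrightarrow> - N \<le> a \<longrightarrow> a + int d \<le> N \<longrightarrow>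
        \<theta> * \<bar>\<Sum>i\<in>{a..<a + int d}. h i\<bar> \<le> sqrt (real d)) \<and>
     (\<forall>x s. x \<in> {- M..M} \<longrightarrow> s \<in> {-1, 1} \<longrightarrow> (\<exists>y. x < y \<and> 0 \<le> x + y \<and> (y - x)\<^sup>2 \<le> R - y
        \<and> (y - x)\<^sup>2 \<le> R + x \<and> 6 \<le> - \<theta> * (s * (\<Sum>i\<in>{x..<y}. h i)))) \<and>
     (\<forall>s\<in>{-1, 1}. \<exists>a. 0 \<le> a \<and> a + int l \<le> Q \<and> (\<forall>i\<in>{a..<a + int l}. h i = - s)) \<and>
     (\<forall>s\<in>{-1, 1}. \<exists>a. - Q \<le> a \<and> a + int l \<le> 0 \<and> (\<forall>i\<in>{a..<a + int l}. h i = - s))"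

text \<open>A union bound over three families of cylinder events, each of probability at most exp (-
  4 \<beta>): isolated runs (\<open>A1\<close>), a lone wall near the origin (\<open>A2\<close>),
  and agreement with the origin's sign throughout a hostile block (\<open>A3\<close>). Off their
  union the run contains {0..M} and stays inside {- Q..Q}.\<close>

lemma gibbs_run_estimate:
  assumes gibbs: "gibbs_measure J1 \<beta> \<theta> h \<mu>" and J: "10 \<le> J1" and \<beta>: "0 \<le> \<beta>" and \<theta>: "0 \<le> \<theta>"
    and params: "1 \<le> M" "M < R" "R + (2 * R)\<^sup>2 \<le> N" "1 \<le> l"
    and good: "good_field \<theta> M R N l Q h"
    and l: "4 \<le> 2 * \<theta> * real l - 4 * J1 - 8 - 16 * sqrt (real l)"
  shows "1 - 24 * (real_of_int N)\<^sup>2 * exp (- \<beta> * 4) \<le> measure \<mu> {sig \<in> space spin_space.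
     (M \<le> int (card (run0 sig)) \<and> int (card (run0 sig)) \<le> 2 * Q + 1) \<and> finite (run0 sig)}"
proof -
  have weak: "\<theta> * \<bar>\<Sum>i\<in>{a..<a + int d}. h i\<bar> \<le> sqrt (real d)"
    if "1 \<le> d" "- N \<le> a" "a + int d \<le> N" for a d
    using good that unfolding good_field_def by simp
  have move: "\<exists>y. x < y \<and> 0 \<le> x + y \<and> (y - x)\<^sup>2 \<le> R - y
      \<and> (y - x)\<^sup>2 \<le> R + x \<and> 6 \<le> - \<theta> * (s * (\<Sum>i\<in>{x..<y}. h i))"
    if "x \<in> {- M..M}" "s \<in> {-1, 1}" for x s
    using good[unfolded good_field_def, THEN conjunct2, THEN conjunct1, rule_format, OF that] .
  have block: "\<exists>a. 0 \<le> a \<and> a + int l \<le> Q \<and> (\<forall>i\<in>{a..<a + int l}. h i = - s)"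
    "\<exists>a. - Q \<le> a \<and> a + int l \<le> 0 \<and> (\<forall>i\<in>{a..<a + int l}. h i = - s)" if "s \<in> {-1, 1}" for s
    using good that unfolding good_field_def by blast+
  have sets: "sets \<mu> = sets spin_space" and "prob_space \<mu>" using gibbs by (auto simp: gibbs_measure_def)
  interpret prob_space \<mu> by fact
  have space: "space \<mu> = space spin_space" using sets by (rule sets_eq_imp_space_eq)
  have J0: "0 \<le> J1" using J by simp
  have spin: "sig j \<in> {-1, 1}" if "sig \<in> space spin_space" for sig j
    using that by (auto simp: space_spin_space)
  define e where "e = exp (- \<beta> * 4)"
  obtain b1 where b1: "\<And>s. s \<in> {-1, 1} \<Longrightarrow> 0 \<le> b1 s \<and> b1 s + int l \<le> Q \<and> (\<forall>i\<in>{b1 s..<b1 s + int l}. h i = - s)"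
    using block(1) by metis
  obtain b2 where b2: "\<And>s. s \<in> {-1, 1} \<Longrightarrow> - Q \<le> b2 s \<and> b2 s + int l \<le> 0 \<and> (\<forall>i\<in>{b2 s..<b2 s + int l}. h i = - s)"
    using block(2) by metis
  define A1 where "A1 = (\<lambda>(a, d, s). {sig \<in> space spin_space. isolated_run sig a d s})"
  define A2 where "A2 = (\<lambda>(x, s). {sig \<in> space spin_space.
     \<forall>j\<in>{- R..<R}. sig j = (if j < x then - s else s)})"
  define A3 where "A3 = (\<lambda>(b, s). {sig \<in> space spin_space. \<forall>j\<in>{b s..<b s + int l}. sig j = s})"
  define I1 where "I1 = {- N..N} \<times> {1..nat (2 * N)} \<times> {-1, 1::real}"
  define I2 where "I2 = {- M..M} \<times> {-1, 1::real}"
  define I3 where "I3 = {b1, b2} \<times> {-1, 1::real}"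
  have fin: "finite I1" "finite I2" "finite I3" by (auto simp: I1_def I2_def I3_def)
  have s1: "A1 k \<in> sets spin_space" for k
  proof -
    obtain a d s where k: "k = (a, d, s)" by (cases k)
    have "A1 k = {sig \<in> space spin_space. \<forall>i\<in>{a - int d..<a + 2 * int d}.
        sig i = (if i \<in> {a..<a + int d} then s else - s)}"
      unfolding A1_def isolated_run_def k by auto
    thus ?thesis using sets_spin_cylinder by auto
  qed
  have s2: "A2 k \<in> sets spin_space" for k
    unfolding A2_def by (cases k) (simp only: prod.case, intro sets_spin_cylinder, simp)
  have s3: "A3 k \<in> sets spin_space" for k
    unfolding A3_def by (cases k) (simp only: prod.case, intro sets_spin_cylinder, simp)
  have sm: "A1 ` I1 \<subseteq> events" "A2 ` I2 \<subseteq> events" "A3 ` I3 \<subseteq> events" using s1 s2 s3 sets by auto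
  have m1: "prob (A1 k) \<le> e" if "k \<in> I1" "- N \<le> fst k" "fst k + int (fst (snd k)) \<le> N" for k
  proof -
    obtain a d s where k: "k = (a, d, s)" by (cases k)
    show ?thesis unfolding e_def
    proof (rule flip_bound[OF gibbs J0 \<beta>, of "{a..<a + int d}" s])
      fix sig assume "sig \<in> A1 k"
      hence sig: "sig \<in> space spin_space" "isolated_run sig a d s" by (auto simp: A1_def k)
      show "4 \<le> flip_gain J1 \<theta> h {a..<a + int d} s sig"
        using that k sig \<theta>
        by (intro flip_gain_isolated_run J weak spin[OF sig(1)]) (auto simp: I1_def isolated_run_def)
      show "sig i = s" if "i \<in> {a..<a + int d}" for i using sig that by (auto simp: isolated_run_def)
    qed (use that k s1 in \<open>auto simp: I1_def\<close>)
  qed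
  \<comment> \<open>The product \<open>I1\<close> is easy to count, but the flip estimate applies
    only to intervals lying inside the window {- N..N}.\<close>
  define I1' where "I1' = {k \<in> I1. - N \<le> fst k \<and> fst k + int (fst (snd k)) \<le> N}"
  have fin1: "finite I1'" "I1' \<subseteq> I1" using fin by (auto simp: I1'_def)
  have m2: "prob (A2 k) \<le> e" if "k \<in> I2" for k
  proof -
    obtain x s where k: "k = (x, s)" by (cases k)
    have "x \<in> {- M..M}" "s \<in> {-1, 1}" using that by (auto simp: I2_def k)
    from move[OF this] obtain y where y: "x < y" "0 \<le> x + y" "(y - x)\<^sup>2 \<le> R - y" "(y - x)\<^sup>2 \<le> R + x"
      "6 \<le> - \<theta> * (s * (\<Sum>i\<in>{x..<y}. h i))"
      by blast
    have "0 \<le> (y - x)\<^sup>2" by simp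
    hence yR: "y \<le> R" "- R \<le> x" using y by linarith+
    show ?thesis unfolding e_def
    proof (rule flip_bound[OF gibbs J0 \<beta>, of "{x..<y}" s])
      fix sig assume "sig \<in> A2 k"
      hence sig: "sig \<in> space spin_space" "\<And>j. j \<in> {- R..<R} \<Longrightarrow> sig j = (if j < x then - s else s)"
        by (auto simp: A2_def k)
      show "4 \<le> flip_gain J1 \<theta> h {x..<y} s sig"
        using that k y(1) yR
        by (intro flip_gain_move_wall[OF J0 _ _ y(1-4) _ _ y(5)] spin[OF sig(1)]) (auto simp: I2_def sig(2))
      show "sig i = s" if "i \<in> {x..<y}" for i using yR that by (simp add: sig(2))
    qed (use that k s2 in \<open>auto simp: I2_def\<close>)
  qed
  have m3: "prob (A3 k) \<le> e" if "k \<in> I3" for k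
  proof -
    obtain b s where k: "k = (b, s)" by (cases k)
    have s: "s \<in> {-1, 1}" and b: "\<forall>i\<in>{b s..<b s + int l}. h i = - s"
      using that b1[of s] b2[of s] by (auto simp: I3_def k)
    show ?thesis unfolding e_def
    proof (rule flip_bound[OF gibbs J0 \<beta>, of "{b s..<b s + int l}" s])
      fix sig assume "sig \<in> A3 k"
      hence sig: "sig \<in> space spin_space" "\<And>j. j \<in> {b s..<b s + int l} \<Longrightarrow> sig j = s"
        by (auto simp: A3_def k)
      show "4 \<le> flip_gain J1 \<theta> h {b s..<b s + int l} s sig"
        using flip_gain_uniform_field[where sig = sig, OF J0 s params(4) spin[OF sig(1)], of "b s" h \<theta>] b l
        by auto
      show "sig i = s" if "i \<in> {b s..<b s + int l}" for i using sig that by auto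
    qed (use s s3 in auto)
  qed
  define B where "B = (\<Union>k\<in>I1'. A1 k) \<union> (\<Union>k\<in>I2. A2 k) \<union> (\<Union>k\<in>I3. A3 k)"
  have Bs: "B \<in> events" unfolding B_def
    using fin fin1 s1 s2 s3 sets by (intro sets.Un sets.finite_UN) auto
  have U: "prob (\<Union>k\<in>I. A k) \<le> real (card I) * e"
    if "finite I" "A ` I \<subseteq> events" "\<And>k. k \<in> I \<Longrightarrow> prob (A k) \<le> e" for I and A :: "'k \<Rightarrow> _"
  proof -
    have "prob (\<Union>k\<in>I. A k) \<le> (\<Sum>k\<in>I. prob (A k))"
      using that by (intro finite_measure_subadditive_finite) auto
    also have "\<dots> \<le> (\<Sum>k\<in>I. e)" using that by (intro sum_mono) auto
    finally show ?thesis by simp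
  qed
  have N: "1 \<le> N" "M \<le> N" using params zero_le_power2[of "2 * R"] by linarith+
  have "prob B \<le> real (card I1') * e + real (card I2) * e + real (card I3) * e"
    unfolding B_def
    using fin fin1 sm m1 m2 m3 s1 s2 s3 sets
    by (intro order_trans[OF measure_Un_le] add_mono U sets.Un sets.finite_UN) (auto simp: I1'_def)
  also have "\<dots> = real (card I1' + card I2 + card I3) * e" by (simp add: algebra_simps)
  \<comment> \<open>The isolated runs account for 12 N^2 (at most 3 N positions, 2 N lengths, 2
    signs); the other two families are each bounded crudely by 6 N^2.\<close>
  also have "\<dots> \<le> 24 * (real_of_int N)\<^sup>2 * e"
  proof (rule mult_right_mono)
    have "int (card I1') \<le> int (card I1)" using fin(1) fin1(2) by (simp add: card_mono)
    also have "\<dots> = (2 * N + 1) * (2 * N) * 2"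
      using N(1) by (simp add: I1_def card_cartesian_product)
    also have "\<dots> \<le> (3 * N) * (2 * N) * 2" using N(1) by (intro mult_right_mono) auto
    finally have c1: "int (card I1') \<le> 12 * N\<^sup>2" by (simp add: power2_eq_square)
    have "int (card I2) = 4 * M + 2" using params(1) by (simp add: I2_def card_cartesian_product)
    moreover have "N \<le> N\<^sup>2" using N(1) by (simp add: power2_eq_square)
    ultimately have c2: "int (card I2) \<le> 6 * N\<^sup>2" using N by linarith
    have "card I3 \<le> 4" unfolding I3_def by (auto simp: card_cartesian_product card_insert_if)
    hence c3: "int (card I3) \<le> 6 * N\<^sup>2" using \<open>N \<le> N\<^sup>2\<close> N by linarith
    have "int (card I1' + card I2 + card I3) \<le> 24 * N\<^sup>2" using c1 c2 c3 by simp
    hence "real_of_int (int (card I1' + card I2 + card I3)) \<le> real_of_int (24 * N\<^sup>2)"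
      unfolding of_int_le_iff .
    thus "real (card I1' + card I2 + card I3) \<le> 24 * (real_of_int N)\<^sup>2" by simp
  qed (simp add: e_def)
  finally have PB: "prob B \<le> 24 * (real_of_int N)\<^sup>2 * e" .
  let ?G = "{sig \<in> space spin_space.
     (M \<le> int (card (run0 sig)) \<and> int (card (run0 sig)) \<le> 2 * Q + 1) \<and> finite (run0 sig)}"
  have "space \<mu> - B \<subseteq> ?G"
  proof
    fix sig assume sig: "sig \<in> space \<mu> - B"
    hence sp: "sig \<in> space spin_space" using space by simp
    have no: "\<not> isolated_run sig a d s"
      if "1 \<le> d" "- N \<le> a" "a + int d \<le> N" "s \<in> {-1, 1}" for a d s
    proof
      assume "isolated_run sig a d s"
      moreover have "(a, d, s) \<in> I1'" using that by (auto simp: I1'_def I1_def)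
      ultimately show False using sig sp by (force simp: B_def A1_def)
    qed
    have nowall: "sig (x - 1) = sig x" if "x \<in> {- M..M}" for x
    proof (rule ccontr)
      assume ne: "sig (x - 1) \<noteq> sig x"
      have "- R < x" "x < R" using that params by auto
      note * = single_wall[OF spin[OF sp] no params(3) this ne]
      have "sig j = (if j < x then - sig x else sig x)" if "j \<in> {- R..<R}" for j
        using *(1)[rule_format, of j] *(2)[rule_format, of j] that by (cases "j < x") simp_all
      hence "\<forall>j\<in>{- R..<R}. sig j = (if j < x then - sig x else sig x)" by (rule ballI)
      with sp have "sig \<in> A2 (x, sig x)" unfolding A2_def prod.case mem_Collect_eq by (rule conjI)
      moreover have "(x, sig x) \<in> I2" using that spin[OF sp, of x] by (auto simp: I2_def)
      ultimately show False using sig by (auto simp: B_def)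
    qed
    have up: "sig (int n) = sig 0" if "int n \<le> M" for n
      using that
    proof (induction n)
      case (Suc n)
      have "sig (int (Suc n) - 1) = sig (int (Suc n))" using Suc.prems by (intro nowall) auto
      thus ?case using Suc by simp
    qed simp
    have down: "sig (- int n) = sig 0" if "int n \<le> M" for n
      using that
    proof (induction n)
      case (Suc n)
      have "sig (- int n - 1) = sig (- int n)" using Suc by (intro nowall) auto
      moreover have "- int n - 1 = - int (Suc n)" by simp
      ultimately show ?case using Suc by simp
    qed simp
    have c: "sig k = sig 0" if "- M \<le> k" "k \<le> M" for k
      using up[of "nat k"] down[of "nat (- k)"] that by (cases "0 \<le> k") auto
    have low: "{0..M} \<subseteq> run0 sig"
      unfolding run0_def using params(1) by (auto intro!: c)
    have s0: "sig 0 \<in> {-1, 1}" by (rule spin[OF sp])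
    \<comment> \<open>The block is selected by the sign at the origin: on \<open>b (sig 0)\<close>
      the field is \<open>- sig 0\<close>, so outside \<open>B\<close> the spins there cannot all
      equal \<open>sig 0\<close>, and the run cannot cross the block.\<close>
    have nb: "\<not> (\<forall>j\<in>{b (sig 0)..<b (sig 0) + int l}. sig j = sig 0)" if "b \<in> {b1, b2}" for b
    proof
      assume "\<forall>j\<in>{b (sig 0)..<b (sig 0) + int l}. sig j = sig 0"
      with sp have "sig \<in> A3 (b, sig 0)" unfolding A3_def prod.case mem_Collect_eq by (rule conjI)
      moreover have "(b, sig 0) \<in> I3" using that s0 by (auto simp: I3_def)
      ultimately show False using sig by (auto simp: B_def)
    qed
    have upp: "run0 sig \<subseteq> {- Q..Q}"
    proof
      fix i assume i: "i \<in> run0 sig"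
      hence i': "sig k = sig 0" if "min 0 i \<le> k" "k \<le> max 0 i" for k
        using that unfolding run0_def mem_Collect_eq by blast
      have "i \<le> Q"
      proof (rule ccontr)
        assume "\<not> i \<le> Q"
        thus False using nb[of b1] b1[OF s0] by (auto intro!: i')
      qed
      moreover have "- Q \<le> i"
      proof (rule ccontr)
        assume "\<not> - Q \<le> i"
        thus False using nb[of b2] b2[OF s0] by (auto intro!: i')
      qed
      ultimately show "i \<in> {- Q..Q}" by simp
    qed
    have f: "finite (run0 sig)" using upp by (rule finite_subset) simp
    have "card {0..M} \<le> card (run0 sig)" using low f by (rule card_mono[rotated])
    moreover have "card (run0 sig) \<le> card {- Q..Q}" using upp by (intro card_mono) auto
    moreover have "0 \<le> Q" using b1[OF s0] by auto
    ultimately show "sig \<in> ?G" using sp f params(1) by auto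
  qed
  hence "prob (space \<mu> - B) \<le> prob ?G"
    by (rule finite_measure_mono) (unfold sets, rule sets_run0)
  moreover have "prob (space \<mu> - B) = 1 - prob B" by (rule prob_compl[OF Bs])
  ultimately show ?thesis using PB by (simp add: e_def)
qed

section \<open>The random field\<close>

locale coin_field = prob_space P for P :: "'w measure" +
  fixes h :: "'w \<Rightarrow> int \<Rightarrow> real"
  assumes indep: "indep_vars (\<lambda>_. borel) (\<lambda>i \<omega>. h \<omega> i) UNIV"
    and plus: "\<And>i. prob {\<omega> \<in> space P. h \<omega> i = 1} = 1/2"
    and minus: "\<And>i. prob {\<omega> \<in> space P. h \<omega> i = -1} = 1/2"
begin

lemma measurable_h [measurable]: "(\<lambda>\<omega>. h \<omega> i) \<in> borel_measurable P"
  using indep by (simp add: indep_vars_def)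

text \<open>The hypotheses are symmetric under h |-> - h. So upward excursions and blocks of value 1
  need to be treated only once; the opposite sign comes from interpreting the locale again.\<close>

lemma coin_field_uminus: "coin_field P (\<lambda>\<omega> i. - h \<omega> i)"
proof unfold_locales
  show "indep_vars (\<lambda>_. borel) (\<lambda>i \<omega>. - h \<omega> i) UNIV"
    using indep_vars_compose2[OF indep, where Y = "\<lambda>_ x. - x" and N = "\<lambda>_. borel"] by simp
  show "prob {\<omega> \<in> space P. - h \<omega> i = 1} = 1/2" for i
  proof -
    have "- h \<omega> i = 1 \<longleftrightarrow> h \<omega> i = - 1" for \<omega> by linarith
    thus ?thesis using minus[of i] by simp
  qed
  show "prob {\<omega> \<in> space P. - h \<omega> i = - 1} = 1/2" for i
    using plus[of i] by simp
qed

lemma AE_h: "AE \<omega> in P. h \<omega> i \<in> {-1, 1}"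
proof -
  let ?A = "{\<omega> \<in> space P. h \<omega> i = 1}" and ?B = "{\<omega> \<in> space P. h \<omega> i = -1}"
  have "prob (?A \<union> ?B) = prob ?A + prob ?B" by (rule finite_measure_Union) auto
  hence "prob (?A \<union> ?B) = 1" using plus minus by simp
  hence "AE \<omega> in P. \<omega> \<in> ?A \<union> ?B" by (subst (asm) prob_eq_1) auto
  thus ?thesis by eventually_elim auto
qed

lemma expectation_h: "expectation (\<lambda>\<omega>. h \<omega> i) = 0"
proof -
  let ?A = "{\<omega> \<in> space P. h \<omega> i = 1}" and ?B = "{\<omega> \<in> space P. h \<omega> i = -1}"
  have "expectation (\<lambda>\<omega>. h \<omega> i) = expectation (\<lambda>\<omega>. indicator ?A \<omega> - indicator ?B \<omega>)"
    using AE_h[of i] AE_space by (intro integral_cong_AE) (auto simp: indicator_def)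
  also have "\<dots> = prob ?A - prob ?B" 
    by (subst Bochner_Integration.integral_diff) (auto intro!: integrable_real_indicator simp: emeasure_eq_measure)
  finally show ?thesis using plus minus by simp
qed

lemma field_sum_tail:
  assumes "finite I" "I \<noteq> {}" "0 \<le> t"
  shows "prob {\<omega> \<in> space P. t \<le> \<bar>\<Sum>i\<in>I. h \<omega> i\<bar>} \<le> 2 * exp (- t\<^sup>2 / (2 * real (card I)))"
proof -
  interpret Hoeffding_ineq P I "\<lambda>i \<omega>. h \<omega> i" "\<lambda>_. -1" "\<lambda>_. 1" 0
  proof unfold_locales
    show "indep_vars (\<lambda>_. borel) (\<lambda>i \<omega>. h \<omega> i) I" by (rule indep_vars_subset[OF indep]) auto
    show "AE \<omega> in P. h \<omega> i \<in> {-1..1}" for i using AE_h[of i] by eventually_elim auto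
    show "0 \<equiv> (\<Sum>i\<in>I. expectation (\<lambda>\<omega>. h \<omega> i))" by (simp add: expectation_h)
  qed (rule assms)
  have "0 < (\<Sum>i\<in>I. (1 - (- 1::real))\<^sup>2)" using assms by (simp add: card_gt_0_iff)
  from Hoeffding_ineq_abs_ge[OF assms(3) this] show ?thesis by simp
qed

section \<open>Independence over disjoint sites and escape times of partial sums\<close>

lemma prob_disjoint_blocks:
  assumes "A \<inter> B = {}"
    and "{f \<in> space (PiM A (\<lambda>_. borel)). Q f} \<in> sets (PiM A (\<lambda>_. borel))"
    and "{f \<in> space (PiM B (\<lambda>_. borel)). Q' f} \<in> sets (PiM B (\<lambda>_. borel))"
    and "\<And>\<omega>. R \<omega> \<longleftrightarrow> Q (restrict (h \<omega>) A)" "\<And>\<omega>. R' \<omega> \<longleftrightarrow> Q' (restrict (h \<omega>) B)"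
  shows "prob {\<omega> \<in> space P. R \<omega> \<and> R' \<omega>} = prob {\<omega> \<in> space P. R \<omega>} * prob {\<omega> \<in> space P. R' \<omega>}"
proof -
  let ?f = "\<lambda>\<omega>. restrict (h \<omega>) A" and ?g = "\<lambda>\<omega>. restrict (h \<omega>) B"
  let ?X = "{f \<in> space (PiM A (\<lambda>_. borel)). Q f}" and ?Y = "{f \<in> space (PiM B (\<lambda>_. borel)). Q' f}"
  have "indep_var (PiM A (\<lambda>_. borel)) ?f (PiM B (\<lambda>_. borel)) ?g"
    using indep_var_restrict[OF indep assms(1)] by simp
  from indep_varD[OF this assms(2,3)]
  have "prob ((\<lambda>x. (?f x, ?g x)) -` (?X \<times> ?Y) \<inter> space P)
    = prob (?f -` ?X \<inter> space P) * prob (?g -` ?Y \<inter> space P)" .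
  moreover have "?f \<omega> \<in> space (PiM A (\<lambda>_. borel))" "?g \<omega> \<in> space (PiM B (\<lambda>_. borel))" for \<omega>
    by (auto simp: space_PiM)
  hence "(\<lambda>x. (?f x, ?g x)) -` (?X \<times> ?Y) \<inter> space P = {\<omega> \<in> space P. R \<omega> \<and> R' \<omega>}"
    "?f -` ?X \<inter> space P = {\<omega> \<in> space P. R \<omega>}" "?g -` ?Y \<inter> space P = {\<omega> \<in> space P. R' \<omega>}"
    using assms(4,5) by auto
  ultimately show ?thesis by simp
qed

text \<open>Survival below level x for the walk with steps read from site k on. Time t = 0 is
  included, so the value is 0 for x <= 0, the absorbing boundary of the recursion. The starting site
  is a parameter because conditioning on one step moves it to k + 1.\<close>

definition stay_prob :: "nat \<Rightarrow> real \<Rightarrow> int \<Rightarrow> real" where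
  "stay_prob n x k = prob {\<omega> \<in> space P. \<forall>t\<le>n. (\<Sum>i<t. h \<omega> (k + int i)) < x}"

text \<open>First-step analysis: a step of +1 or -1 changes the remaining level to x - 1 or x + 1,
  and the later steps are independent of it. Values of h other than these have probability
  0.\<close>

lemma stay_prob_step:
  "stay_prob (Suc n) x k \<le> (stay_prob n (x - 1) (k + 1) + stay_prob n (x + 1) (k + 1)) / 2"
proof -
  let ?S = "\<lambda>n x k \<omega>. \<forall>t\<le>n. (\<Sum>i<t. h \<omega> (k + int i)) < x"
  have half: "prob {\<omega> \<in> space P. h \<omega> k = e \<and> ?S n z (k + 1) \<omega>} = stay_prob n z (k + 1) / 2"
    if e: "e \<in> {-1, 1}" for e z
  proof -
    let ?B = "{k + 1..<k + 1 + int n}"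
    have "prob {\<omega> \<in> space P. h \<omega> k = e \<and> ?S n z (k + 1) \<omega>}
      = prob {\<omega> \<in> space P. h \<omega> k = e} * prob {\<omega> \<in> space P. ?S n z (k + 1) \<omega>}"
    proof (rule prob_disjoint_blocks[where A = "{k}" and B = ?B])
      show "{f \<in> space (PiM {k} (\<lambda>_. borel)). f k = e} \<in> sets (PiM {k} (\<lambda>_. borel :: real measure))"
        by measurable
      have [measurable]: "(\<lambda>f. f (k + 1 + int i)) \<in> borel_measurable (PiM ?B (\<lambda>_. borel :: real measure))"
        if "i < n" for i
        using that by (intro measurable_component_singleton) auto
      show "{f \<in> space (PiM ?B (\<lambda>_. borel)). \<forall>t\<le>n. (\<Sum>i<t. f (k + 1 + int i)) < z}
        \<in> sets (PiM ?B (\<lambda>_. borel :: real measure))"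
      proof -
        have "(\<lambda>f. \<Sum>i<t. f (k + 1 + int i)) \<in> borel_measurable (PiM ?B (\<lambda>_. borel :: real measure))"
          if "t \<le> n" for t
          using that by (intro borel_measurable_sum) auto
        hence "{f \<in> space (PiM ?B (\<lambda>_. borel)). (\<Sum>i<t. f (k + 1 + int i)) < z}
           \<in> sets (PiM ?B (\<lambda>_. borel :: real measure))" if "t \<in> {..n}" for t
          using that by (intro borel_measurable_less) auto
        from sets.sets_Collect_finite_All[OF this finite_atMost] show ?thesis by simp
      qed
    qed auto
    thus ?thesis using e plus minus by (auto simp: stay_prob_def)
  qed
  have "stay_prob (Suc n) x k
    \<le> prob ({\<omega> \<in> space P. h \<omega> k = 1 \<and> ?S n (x - 1) (k + 1) \<omega>}
        \<union> {\<omega> \<in> space P. h \<omega> k = -1 \<and> ?S n (x + 1) (k + 1) \<omega>})"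
    unfolding stay_prob_def
  proof (rule finite_measure_mono_AE)
    show "AE \<omega> in P. \<omega> \<in> {\<omega> \<in> space P. ?S (Suc n) x k \<omega>} \<longrightarrow>
      \<omega> \<in> {\<omega> \<in> space P. h \<omega> k = 1 \<and> ?S n (x - 1) (k + 1) \<omega>}
        \<union> {\<omega> \<in> space P. h \<omega> k = -1 \<and> ?S n (x + 1) (k + 1) \<omega>}"
      using AE_h[of k]
    proof eventually_elim
      case (elim \<omega>)
      have "h \<omega> k + (\<Sum>i<t. h \<omega> (k + 1 + int i)) < x" if "?S (Suc n) x k \<omega>" "t \<le> n" for t
        using that(1)[rule_format, of "Suc t"] that(2)
        by (simp add: sum.lessThan_Suc_shift add_ac del: sum.lessThan_Suc)
      thus ?case using elim by fastforce
    qed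
  qed auto
  also have "\<dots> \<le> stay_prob n (x - 1) (k + 1) / 2 + stay_prob n (x + 1) (k + 1) / 2"
    by (rule order_trans[OF measure_Un_le]) (auto simp: half)
  finally show ?thesis by (simp add: field_simps)
qed

lemma stay_prob_antimono: "m \<le> n \<Longrightarrow> stay_prob n x k \<le> stay_prob m x k"
  unfolding stay_prob_def by (intro finite_measure_mono) auto

text \<open>The function \<open>x (L - x) + n x / L\<close> is a supersolution of the recursion for the expected time
  that the walk needs to rise by \<open>x\<close>, truncated at \<open>n\<close>.\<close>
lemma sum_stay_prob_le:
  "x \<le> L \<Longrightarrow> 0 < L \<Longrightarrow>
    (\<Sum>m<n. stay_prob m (real x) k) \<le> real x * (real L - real x) + real n * real x / real L"
proof (induction n arbitrary: x k)
  case (Suc n)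
  have le1: "stay_prob m z k \<le> 1" for m z unfolding stay_prob_def by (rule prob_le_1)
  consider "x = 0" | "x = L" | "0 < x" "x < L" using Suc.prems by linarith
  thus ?case
  proof cases
    case 1
    have "stay_prob m 0 k = 0" for m
    proof -
      have "{\<omega> \<in> space P. \<forall>t\<le>m. (\<Sum>i<t. h \<omega> (k + int i)) < 0} = {}"
        by (auto intro!: exI[of _ 0])
      thus ?thesis unfolding stay_prob_def by (simp only: measure_empty)
    qed
    thus ?thesis using 1 by simp
  next
    \<comment> \<open>At the far end x = L the term n x / L equals n, the trivial bound for n
      probabilities.\<close>
    case 2
    have "(\<Sum>m<Suc n. stay_prob m (real x) k) \<le> (\<Sum>m<Suc n. 1)" by (intro sum_mono le1)
    thus ?thesis using 2 Suc.prems by simp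
  next
    case 3
    have "(\<Sum>m<Suc n. stay_prob m (real x) k)
       = stay_prob 0 (real x) k + (\<Sum>m<n. stay_prob (Suc m) (real x) k)"
      by (rule sum.lessThan_Suc_shift)
    also have "\<dots> \<le> 1 + (\<Sum>m<n. (stay_prob m (real x - 1) (k + 1) + stay_prob m (real x + 1) (k + 1)) / 2)"
      by (intro add_mono le1 sum_mono stay_prob_step)
    also have "\<dots> = 1 + ((\<Sum>m<n. stay_prob m (real (x - 1)) (k + 1))
        + (\<Sum>m<n. stay_prob m (real (x + 1)) (k + 1))) / 2"
      using 3 by (simp add: sum.distrib of_nat_diff add.commute[of 1] flip: sum_divide_distrib)
    also have "\<dots> \<le> 1 + ((real (x - 1) * (real L - real (x - 1)) + real n * real (x - 1) / real L)
        + (real (x + 1) * (real L - real (x + 1)) + real n * real (x + 1) / real L)) / 2"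
      using 3 by (intro add_left_mono divide_right_mono add_mono Suc.IH) auto
    \<comment> \<open>Averaging x (L - x) over both neighbours of x lowers it by exactly 1, which
      cancels the leading 1; the other term is linear in x and unchanged.\<close>
    also have "\<dots> = real x * (real L - real x) + real n * real x / real L"
      using 3 by (simp add: of_nat_diff field_simps)
    also have "\<dots> \<le> real x * (real L - real x) + real (Suc n) * real x / real L"
      by (intro add_left_mono divide_right_mono mult_right_mono) auto
    finally show ?thesis .
  qed
qed simp

text \<open>Survival decreases in time, so its value at time L^2 is at most the average over the
  first L^2 times. With n = L^2 both terms of the supersolution are at most x L.\<close>

lemma stay_prob_le:
  assumes "x \<le> L" "0 < L"
  shows "stay_prob (L\<^sup>2) (real x) k \<le> 2 * real x / real L"
proof -
  have "real (L\<^sup>2) * stay_prob (L\<^sup>2) (real x) k = (\<Sum>m<L\<^sup>2. stay_prob (L\<^sup>2) (real x) k)" by simp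
  also have "\<dots> \<le> (\<Sum>m<L\<^sup>2. stay_prob m (real x) k)" by (intro sum_mono stay_prob_antimono) auto
  also have "\<dots> \<le> real x * (real L - real x) + real (L\<^sup>2) * real x / real L"
    by (rule sum_stay_prob_le[OF assms])
  also have "\<dots> \<le> real (L\<^sup>2) * (2 * real x / real L)"
    using assms by (simp add: power2_eq_square field_simps)
  finally show ?thesis by (rule mult_left_le_imp_le) (use assms in simp)
qed

section \<open>Blocks of constant field\<close>

lemma prob_block: "prob {\<omega> \<in> space P. \<forall>i\<in>{c..<c + int l}. h \<omega> i = 1} = (1/2) ^ l"
proof (cases "l = 0")
  case False
  have "{\<omega> \<in> space P. \<forall>i\<in>{c..<c + int l}. h \<omega> i = 1}
     = (\<Inter>i\<in>{c..<c + int l}. (\<lambda>\<omega>. h \<omega> i) -` {1} \<inter> space P)" using False by auto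
  also have "prob \<dots> = (\<Prod>i\<in>{c..<c + int l}. prob ((\<lambda>\<omega>. h \<omega> i) -` {1} \<inter> space P))"
    using False by (intro indep_varsD[OF indep]) auto
  also have "\<dots> = (\<Prod>i\<in>{c..<c + int l}. 1/2)"
  proof (rule prod.cong[OF refl])
    fix i
    have "(\<lambda>\<omega>. h \<omega> i) -` {1} \<inter> space P = {\<omega> \<in> space P. h \<omega> i = 1}" by auto
    thus "prob ((\<lambda>\<omega>. h \<omega> i) -` {1} \<inter> space P) = 1/2" using plus by simp
  qed
  finally show ?thesis by simp
qed (simp add: prob_space)

lemma prob_no_block:
  "prob {\<omega> \<in> space P. \<forall>b<q. \<not> (\<forall>i\<in>{c + int (b * l)..<c + int (b * l) + int l}. h \<omega> i = 1)}
    = (1 - (1/2) ^ l) ^ q"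
proof (induction q)
  case (Suc q)
  let ?I = "\<lambda>b. {c + int (b * l)..<c + int (b * l) + int l}"
  let ?A = "{c..<c + int (q * l)}"
  have sub: "?I b \<subseteq> ?A" if "b < q" for b
  proof -
    have "b * l + l \<le> q * l" using that mult_le_mono1[of "Suc b" q l] by simp
    hence "int (b * l) + int l \<le> int (q * l)" unfolding of_nat_add[symmetric] of_nat_le_iff .
    thus ?thesis by (auto simp del: of_nat_mult intro: order_trans[of c "c + int (b * l)"])
  qed
  have comp: "(\<lambda>f. f i) \<in> borel_measurable (PiM B (\<lambda>_. borel :: real measure))" if "i \<in> B" for i and B :: "int set"
    using that by (intro measurable_component_singleton)
  have one: "{f \<in> space (PiM B (\<lambda>_. borel)). f i = 1} \<in> sets (PiM B (\<lambda>_. borel :: real measure))"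
    if "i \<in> B" for i and B :: "int set"
    using comp[OF that] by (intro borel_measurable_eq) auto
  have blk: "{f \<in> space (PiM B (\<lambda>_. borel)). \<not> (\<forall>i\<in>?I b. f i = 1)} \<in> sets (PiM B (\<lambda>_. borel :: real measure))"
    if "?I b \<subseteq> B" for b B
    using that by (intro sets.sets_Collect_neg sets.sets_Collect_finite_All one) auto
  have set_eq: "{\<omega> \<in> space P. \<forall>b<Suc q. \<not> (\<forall>i\<in>?I b. h \<omega> i = 1)}
    = {\<omega> \<in> space P. (\<forall>b<q. \<not> (\<forall>i\<in>?I b. h \<omega> i = 1)) \<and> \<not> (\<forall>i\<in>?I q. h \<omega> i = 1)}"
    by (auto simp: less_Suc_eq)
  have eq: "prob {\<omega> \<in> space P. (\<forall>b<q. \<not> (\<forall>i\<in>?I b. h \<omega> i = 1)) \<and> \<not> (\<forall>i\<in>?I q. h \<omega> i = 1)}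
     = prob {\<omega> \<in> space P. \<forall>b<q. \<not> (\<forall>i\<in>?I b. h \<omega> i = 1)}
     * prob {\<omega> \<in> space P. \<not> (\<forall>i\<in>?I q. h \<omega> i = 1)}"
  proof (rule prob_disjoint_blocks[where A = ?A and B = "?I q"])
    show "{f \<in> space (PiM ?A (\<lambda>_. borel)). \<forall>b<q. \<not> (\<forall>i\<in>?I b. f i = 1)}
       \<in> sets (PiM ?A (\<lambda>_. borel :: real measure))"
    proof -
      have "{f \<in> space (PiM ?A (\<lambda>_. borel)). \<forall>b\<in>{..<q}. \<not> (\<forall>i\<in>?I b. f i = 1)}
         \<in> sets (PiM ?A (\<lambda>_. borel :: real measure))"
      proof (rule sets.sets_Collect_finite_All)
        show "{f \<in> space (PiM ?A (\<lambda>_. borel)). \<not> (\<forall>i\<in>?I b. f i = 1)}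
          \<in> sets (PiM ?A (\<lambda>_. borel :: real measure))" if "b \<in> {..<q}" for b
          using blk[OF sub[of b]] that by (simp only: lessThan_iff)
      qed simp
      thus ?thesis by (simp only: Ball_def lessThan_iff)
    qed
    show "{f \<in> space (PiM (?I q) (\<lambda>_. borel)). \<not> (\<forall>i\<in>?I q. f i = 1)}
       \<in> sets (PiM (?I q) (\<lambda>_. borel :: real measure))" by (rule blk) simp
    show "(\<forall>b<q. \<not> (\<forall>i\<in>?I b. h \<omega> i = 1)) \<longleftrightarrow> (\<forall>b<q. \<not> (\<forall>i\<in>?I b. restrict (h \<omega>) ?A i = 1))" for \<omega>
      using sub by (auto simp: restrict_def subset_iff)
  qed auto
  have "prob {\<omega> \<in> space P. \<not> (\<forall>i\<in>?I q. h \<omega> i = 1)}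
    = 1 - prob {\<omega> \<in> space P. \<forall>i\<in>?I q. h \<omega> i = 1}"
  proof -
    have "{\<omega> \<in> space P. h \<omega> i = 1} \<in> events" for i
      by (intro borel_measurable_eq measurable_h borel_measurable_const)
    hence "{\<omega> \<in> space P. \<forall>i\<in>?I q. h \<omega> i = 1} \<in> events"
      by (intro sets.sets_Collect_finite_All finite_atLeastLessThan_int)
    thus ?thesis by (rule prob_neg[where P = "\<lambda>\<omega>. \<forall>i\<in>?I q. h \<omega> i = 1"])
  qed
  thus ?case unfolding set_eq eq Suc.IH prob_block by simp
qed (simp add: prob_space)

end

text \<open>There are 4^l independent trials of success probability 2^(-l), so all fail with
  probability at most exp (- 2^l), which is weakened to the form used later.\<close>

lemma (in coin_field) prob_no_block_le:
  "prob {\<omega> \<in> space P. \<forall>b<4 ^ l. \<not> (\<forall>i\<in>{c + int (b * l)..<c + int (b * l) + int l}. h \<omega> i = 1)}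
    \<le> exp (- real l)"
proof -
  have "(1 - (1/2) ^ l) ^ (4 ^ l) \<le> exp (- ((1/2::real) ^ l)) ^ (4 ^ l)"
    using exp_ge_add_one_self[of "- ((1/2::real) ^ l)"] by (intro power_mono) (auto simp: power_le_one)
  also have "\<dots> = exp (- (real (4 ^ l) * (1/2) ^ l))" by (simp flip: exp_of_nat_mult)
  also have "real (4 ^ l) * (1/2) ^ l = 2 ^ l" by (simp flip: power_mult_distrib)
  also have "exp (- (2 ^ l)) \<le> exp (- real l)" using of_nat_less_two_power[of l, where 'a = real] by simp
  finally show ?thesis unfolding prob_no_block .
qed

text \<open>The three error terms are the union bound over at most 6 N^2 intervals with two-sided
  Hoeffding, the two walks (one per sign) with 6 / M each, and the four block searches (two signs,
  two sides).\<close>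

lemma (in coin_field) good_field_event:
  fixes M l :: nat
  defines "R \<equiv> int M ^ 10" and "N \<equiv> int M ^ 22"
  assumes \<theta>: "0 < \<theta>" and M: "3 \<le> M" "6 \<le> \<theta> * real M"
  shows "\<exists>E\<in>events.
    1 - (12 * (real M ^ 22)\<^sup>2 * exp (- 1 / (2 * \<theta>\<^sup>2)) + 12 / real M + 4 * exp (- real l)) \<le> prob E \<and>
    (\<forall>\<omega>\<in>E. good_field \<theta> (int M) R N l (int (4 ^ l * l)) (h \<omega>))"
proof -
  interpret m: coin_field P "\<lambda>\<omega> i. - h \<omega> i" by (rule coin_field_uminus)
  define I where "I = {- N..N} \<times> {1..nat (2 * N)}"
  define B1 where "B1 = (\<lambda>(a, d). {\<omega> \<in> space P. sqrt (real d) / \<theta> \<le> \<bar>\<Sum>i\<in>{a..<a + int d}. h \<omega> i\<bar>})"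
  \<comment> \<open>One walk from M serves all wall positions x in {- M..M}: the stretch from x to M
    can cost at most 2 M of the level 3 M, and the remaining M suffices because \<theta> M >= 6.
    Taking L = M^2 in \<open>stay_prob_le\<close> gives 6 / M.\<close>
  define W where "W = (\<lambda>h. {\<omega> \<in> space P. \<forall>t\<le>(M\<^sup>2)\<^sup>2. (\<Sum>i<t. h \<omega> (int M + int i)) < real (3 * M)})"
  define K where "K = (\<lambda>h c. {\<omega> \<in> space P. \<forall>b<4 ^ l.
     \<not> (\<forall>i\<in>{c + int (b * l)..<c + int (b * l) + int l}. h \<omega> i = (1::real))})"
  \<comment> \<open>A null event, removed so that the values of h on the stretch from x to M have
    modulus 1 pointwise rather than almost surely.\<close>
  define B0 where "B0 = (\<Union>i\<in>{- int M..<int M}. {\<omega> \<in> space P. \<not> h \<omega> i \<in> {-1, 1}})"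
  let ?h' = "\<lambda>\<omega> i. - h \<omega> i" and ?c = "- int (4 ^ l * l)"
  define B where "B = (\<Union>k\<in>I. B1 k) \<union> (W h \<union> W ?h') \<union> ((K h 0 \<union> K ?h' 0) \<union> (K h ?c \<union> K ?h' ?c)) \<union> B0"
  have N1: "1 \<le> N" using M by (simp add: N_def)
  have fin: "finite I" by (simp add: I_def)
  have e1: "B1 k \<in> events" for k by (cases k) (simp add: B1_def)
  have e2: "W h \<in> events" "W ?h' \<in> events" by (simp_all add: W_def)
  have e3: "K h c \<in> events" "K ?h' c \<in> events" for c by (simp_all add: K_def)
  have e0: "B0 \<in> events" by (simp add: B0_def)
  have U: "(\<Union>k\<in>I. B1 k) \<in> events" using fin e1 by (intro sets.finite_UN) auto
  have "prob (\<Union>k\<in>I. B1 k) \<le> (\<Sum>k\<in>I. prob (B1 k))"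
    using fin e1 by (intro finite_measure_subadditive_finite) auto
  also have "\<dots> \<le> (\<Sum>k\<in>I. 2 * exp (- 1 / (2 * \<theta>\<^sup>2)))"
  proof (rule sum_mono)
    fix k assume "k \<in> I"
    then obtain a d where k: "k = (a, d)" "1 \<le> d" by (auto simp: I_def)
    have "prob (B1 k) \<le> 2 * exp (- (sqrt (real d) / \<theta>)\<^sup>2 / (2 * real (card {a..<a + int d})))"
      unfolding k B1_def prod.case using k \<theta> by (intro field_sum_tail) auto
    \<comment> \<open>The threshold sqrt d / \<theta> makes the Hoeffding exponent independent of d,
      so all interval lengths share one bound.\<close>
    also have "- (sqrt (real d) / \<theta>)\<^sup>2 / (2 * real (card {a..<a + int d})) = - 1 / (2 * \<theta>\<^sup>2)"
      using k \<theta> by (simp add: power_divide field_simps)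
    finally show "prob (B1 k) \<le> 2 * exp (- 1 / (2 * \<theta>\<^sup>2))" .
  qed
  also have "\<dots> = real (card I) * (2 * exp (- 1 / (2 * \<theta>\<^sup>2)))" by simp
  also have "\<dots> \<le> (6 * (real M ^ 22)\<^sup>2) * (2 * exp (- 1 / (2 * \<theta>\<^sup>2)))"
  proof (rule mult_right_mono)
    have "int (card I) = (2 * N + 1) * (2 * N)" using N1 by (simp add: I_def card_cartesian_product)
    also have "\<dots> \<le> (3 * N) * (2 * N)" using N1 by (intro mult_right_mono) auto
    finally have "int (card I) \<le> 6 * N\<^sup>2" by (simp add: power2_eq_square)
    hence "real_of_int (int (card I)) \<le> real_of_int (6 * N\<^sup>2)" unfolding of_int_le_iff .
    thus "real (card I) \<le> 6 * (real M ^ 22)\<^sup>2" by (simp add: N_def)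
  qed simp
  finally have p1: "prob (\<Union>k\<in>I. B1 k) \<le> 12 * (real M ^ 22)\<^sup>2 * exp (- 1 / (2 * \<theta>\<^sup>2))" by simp
  have M2: "3 * M \<le> M\<^sup>2" "0 < M\<^sup>2" using M by (auto simp: power2_eq_square)
  have "2 * real (3 * M) / real (M\<^sup>2) = 6 / real M" using M by (simp add: power2_eq_square field_simps)
  hence p2: "prob (W h) \<le> 6 / real M" "prob (W ?h') \<le> 6 / real M"
    using stay_prob_le[OF M2, of "int M"] m.stay_prob_le[OF M2, of "int M"]
    unfolding stay_prob_def m.stay_prob_def W_def by linarith+
  have p3: "prob (K h c) \<le> exp (- real l)" "prob (K ?h' c) \<le> exp (- real l)" for c
    unfolding K_def by (rule prob_no_block_le, rule m.prob_no_block_le)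
  have p0: "prob B0 = 0"
  proof -
    have "prob B0 \<le> (\<Sum>i\<in>{- int M..<int M}. prob {\<omega> \<in> space P. \<not> h \<omega> i \<in> {-1, 1}})"
      unfolding B0_def by (intro finite_measure_subadditive_finite) auto
    also have "\<dots> = 0"
    proof (intro sum.neutral ballI)
      fix i
      have "prob {\<omega> \<in> space P. h \<omega> i \<in> {-1, 1}} = 1"
        using AE_h[of i] by (subst prob_Collect_eq_1) auto
      thus "prob {\<omega> \<in> space P. \<not> h \<omega> i \<in> {-1, 1}} = 0" by (subst prob_neg) auto
    qed
    finally show ?thesis using measure_nonneg[of P B0] by simp
  qed
  have Bs: "B \<in> events" unfolding B_def by (intro sets.Un U e0 e2 e3)
  have Ws: "prob (W h \<union> W ?h') \<le> 6 / real M + 6 / real M"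
    using measure_Un_le[OF e2] p2 by linarith
  have Ks: "prob (K h c \<union> K ?h' c) \<le> exp (- real l) + exp (- real l)" for c
    using measure_Un_le[OF e3, of c c] p3[of c] by linarith
  have Ks2: "prob ((K h 0 \<union> K ?h' 0) \<union> (K h ?c \<union> K ?h' ?c)) \<le> 4 * exp (- real l)"
    using measure_Un_le[OF sets.Un[OF e3, of 0 0] sets.Un[OF e3, of ?c ?c]] Ks[of 0] Ks[of ?c] by linarith
  have "prob B \<le> prob ((\<Union>k\<in>I. B1 k) \<union> (W h \<union> W ?h') \<union> ((K h 0 \<union> K ?h' 0) \<union> (K h ?c \<union> K ?h' ?c))) + prob B0"
    unfolding B_def by (intro measure_Un_le sets.Un U e0 e2 e3)
  also have "\<dots> \<le> prob ((\<Union>k\<in>I. B1 k) \<union> (W h \<union> W ?h')) + prob ((K h 0 \<union> K ?h' 0) \<union> (K h ?c \<union> K ?h' ?c)) + prob B0"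
    by (intro add_right_mono measure_Un_le sets.Un U e0 e2 e3)
  also have "\<dots> \<le> prob (\<Union>k\<in>I. B1 k) + prob (W h \<union> W ?h')
      + prob ((K h 0 \<union> K ?h' 0) \<union> (K h ?c \<union> K ?h' ?c)) + prob B0"
    by (intro add_right_mono measure_Un_le sets.Un U e0 e2 e3)
  finally have PB: "prob B \<le> 12 * (real M ^ 22)\<^sup>2 * exp (- 1 / (2 * \<theta>\<^sup>2)) + 12 / real M + 4 * exp (- real l)"
    using p1 Ws Ks2 p0 by linarith
  show ?thesis unfolding good_field_def
  proof (intro bexI[of _ "space P - B"] conjI ballI allI impI)
    show "space P - B \<in> events" using Bs by auto
    show "1 - (12 * (real M ^ 22)\<^sup>2 * exp (- 1 / (2 * \<theta>\<^sup>2)) + 12 / real M + 4 * exp (- real l)) \<le> prob (space P - B)"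
      using PB prob_compl[OF Bs] by linarith
  next
    fix \<omega> a and d :: nat assume \<omega>: "\<omega> \<in> space P - B" and ad: "1 \<le> d" "- N \<le> a" "a + int d \<le> N"
    have "(a, d) \<in> I" using ad by (auto simp: I_def)
    hence "\<omega> \<notin> B1 (a, d)" using \<omega> by (auto simp: B_def)
    hence "\<bar>\<Sum>i\<in>{a..<a + int d}. h \<omega> i\<bar> < sqrt (real d) / \<theta>" using \<omega> by (auto simp: B1_def)
    thus "\<theta> * \<bar>\<Sum>i\<in>{a..<a + int d}. h \<omega> i\<bar> \<le> sqrt (real d)"
      using \<theta> by (simp add: pos_less_divide_eq mult.commute)
  next
    fix \<omega> x and s :: real
    assume \<omega>: "\<omega> \<in> space P - B" and x: "x \<in> {- int M..int M}" and s: "s \<in> {-1, 1}"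
    have pm: "h \<omega> i \<in> {-1, 1}" if "- int M \<le> i" "i < int M" for i
      using \<omega> that by (auto simp: B_def B0_def)
    have "\<exists>t\<le>(M\<^sup>2)\<^sup>2. real (3 * M) \<le> - s * (\<Sum>i<t. h \<omega> (int M + int i))"
    proof -
      have "\<omega> \<notin> W h" "\<omega> \<notin> W ?h'" using \<omega> by (auto simp: B_def)
      thus ?thesis using s \<omega> by (auto simp: W_def not_less sum_negf)
    qed
    then obtain t where t: "t \<le> (M\<^sup>2)\<^sup>2" "real (3 * M) \<le> - s * (\<Sum>i<t. h \<omega> (int M + int i))" by blast
    have t0: "0 < t" using t(2) M by (cases t) auto
    define y where "y = int M + int t"
    have xy: "x < y" "0 \<le> x + y" using x t0 by (auto simp: y_def)
    have "(M\<^sup>2)\<^sup>2 = M ^ 4" by simp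
    hence tM: "int t \<le> int M ^ 4" using t(1) by (metis of_nat_le_iff of_nat_power)
    \<comment> \<open>The displacement is at most 2 M + M^4 <= 2 M^4, its square at most 4 M^8, and
      the positions add at most M + M^4. The total is at most 6 M^8 <= M^10, whence the exponent of
      R.\<close>
    have p: "2 * int M \<le> int M ^ 4" "int M ^ 4 \<le> int M ^ 8" "6 * int M ^ 8 \<le> int M ^ 10"
    proof -
      have "2 * int M \<le> int M ^ 2" using M by (simp add: power2_eq_square)
      also have "\<dots> \<le> int M ^ 4" using M by (intro power_increasing) auto
      finally show "2 * int M \<le> int M ^ 4" .
      show "int M ^ 4 \<le> int M ^ 8" using M by (intro power_increasing) auto
      have "3 * 3 \<le> int M * int M" using M by (intro mult_mono) auto
      hence "6 * int M ^ 8 \<le> int M ^ 2 * int M ^ 8"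
        unfolding power2_eq_square by (intro mult_right_mono) auto
      thus "6 * int M ^ 8 \<le> int M ^ 10" by (simp flip: power_add)
    qed
    have xM: "- int M \<le> x" "x \<le> int M" using x by auto
    have "(y - x)\<^sup>2 \<le> (2 * int M ^ 4)\<^sup>2"
    proof (rule power_mono)
      show "y - x \<le> 2 * int M ^ 4" using xM tM p(1) unfolding y_def by linarith
    qed (use xy in simp)
    also have "\<dots> = 4 * int M ^ 8" by (simp add: power_mult_distrib flip: power_mult)
    finally have "(y - x)\<^sup>2 \<le> R - y" "(y - x)\<^sup>2 \<le> R + x"
      using p xM tM unfolding R_def y_def by linarith+
    moreover have "6 \<le> - \<theta> * (s * (\<Sum>i\<in>{x..<y}. h \<omega> i))"
    proof -
      have "{x..<y} = {x..<int M} \<union> {int M..<int M + int t}" using x by (auto simp: y_def)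
      hence "(\<Sum>i\<in>{x..<y}. h \<omega> i) = (\<Sum>i\<in>{x..<int M}. h \<omega> i) + (\<Sum>i\<in>{int M..<int M + int t}. h \<omega> i)"
        by (simp add: sum.union_disjoint)
      hence S: "- s * (\<Sum>i\<in>{x..<y}. h \<omega> i)
         = - s * (\<Sum>i\<in>{x..<int M}. h \<omega> i) + - s * (\<Sum>i<t. h \<omega> (int M + int i))"
        by (simp add: sum_int_interval algebra_simps)
      have "\<bar>- s * (\<Sum>i\<in>{x..<int M}. h \<omega> i)\<bar> = \<bar>\<Sum>i\<in>{x..<int M}. h \<omega> i\<bar>" using s by auto
      also have "\<dots> \<le> (\<Sum>i\<in>{x..<int M}. \<bar>h \<omega> i\<bar>)" by (rule sum_abs)
      also have "\<dots> \<le> (\<Sum>i\<in>{x..<int M}. 1)"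
      proof (rule sum_mono)
        fix i assume "i \<in> {x..<int M}"
        hence "h \<omega> i \<in> {-1, 1}" using xM by (intro pm) auto
        thus "\<bar>h \<omega> i\<bar> \<le> 1" by auto
      qed
      also have "\<dots> \<le> 2 * real M" using x by simp
      finally have "real M \<le> - s * (\<Sum>i\<in>{x..<y}. h \<omega> i)" using t(2) S by simp
      hence "\<theta> * real M \<le> \<theta> * (- s * (\<Sum>i\<in>{x..<y}. h \<omega> i))" using \<theta> by (intro mult_left_mono) auto
      thus ?thesis using M(2) by simp
    qed
    ultimately show "\<exists>y. x < y \<and> 0 \<le> x + y \<and> (y - x)\<^sup>2 \<le> R - y \<and> (y - x)\<^sup>2 \<le> R + x
        \<and> 6 \<le> - \<theta> * (s * (\<Sum>i\<in>{x..<y}. h \<omega> i))" using xy by blast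
  next
    have block: "\<exists>a. c \<le> a \<and> a + int l \<le> c + int (4 ^ l * l) \<and> (\<forall>i\<in>{a..<a + int l}. h \<omega> i = - s)"
      if \<omega>: "\<omega> \<in> space P - B" and s: "s \<in> {-1, 1}" and c: "c \<in> {0, ?c}" for \<omega> s c
    proof -
      have "\<omega> \<notin> K h c" "\<omega> \<notin> K ?h' c" using \<omega> c by (auto simp: B_def)
      hence "(\<exists>b<4 ^ l. \<forall>i\<in>{c + int (b * l)..<c + int (b * l) + int l}. h \<omega> i = 1)"
        "(\<exists>b<4 ^ l. \<forall>i\<in>{c + int (b * l)..<c + int (b * l) + int l}. - h \<omega> i = 1)"
        using \<omega> unfolding K_def by blast+
      moreover have "- h \<omega> i = 1 \<longleftrightarrow> h \<omega> i = - 1" for i by linarith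
      ultimately obtain b
        where b: "b < 4 ^ l" "\<forall>i\<in>{c + int (b * l)..<c + int (b * l) + int l}. h \<omega> i = - s"
        using s by (cases "s = 1") (simp_all, blast+)
      have "b * l + l \<le> 4 ^ l * l" using b(1) mult_le_mono1[of "Suc b" "4 ^ l" l] by simp
      hence "int (b * l) + int l \<le> int (4 ^ l * l)" unfolding of_nat_add[symmetric] of_nat_le_iff .
      thus ?thesis using b(2) by (intro exI[of _ "c + int (b * l)"] conjI) auto
    qed
    fix \<omega> and s :: real assume "\<omega> \<in> space P - B" "s \<in> {-1, 1}"
    note * = block[OF this]
    show "\<exists>a. 0 \<le> a \<and> a + int l \<le> int (4 ^ l * l) \<and> (\<forall>i\<in>{a..<a + int l}. h \<omega> i = - s)"
      using *[of 0] by simp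
    show "\<exists>a. ?c \<le> a \<and> a + int l \<le> 0 \<and> (\<forall>i\<in>{a..<a + int l}. h \<omega> i = - s)"
      using *[of ?c] by simp
  qed
qed

section \<open>Typical run length\<close>

lemma run_length_bound:
  assumes "1 \<le> l"
  shows "real_of_int (2 * int (4 ^ l * l) + 1) \<le> exp (5 * real l)"
proof -
  have l: "real l \<le> 2 ^ l" using of_nat_less_two_power[of l, where 'a = real] by simp
  have "real_of_int (2 * int (4 ^ l * l) + 1) = 2 * (4 ^ l * real l) + 1" by simp
  also have "\<dots> \<le> 2 * (4 ^ l * 2 ^ l) + 8 ^ l" using l by (intro add_mono mult_left_mono) auto
  also have "\<dots> = 3 * 8 ^ l" by (simp flip: power_mult_distrib)
  also have "\<dots> \<le> 3 ^ l * 8 ^ l" using assms by (intro mult_right_mono self_le_power) auto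
  also have "\<dots> = 24 ^ l" by (simp flip: power_mult_distrib)
  also have "\<dots> \<le> exp 5 ^ l"
  proof (rule power_mono)
    have "(24::real) \<le> 2 ^ 5" by simp
    also have "\<dots> \<le> exp 1 ^ 5" using exp_ge_add_one_self[of 1] by (intro power_mono) auto
    also have "\<dots> = exp 5" by (simp flip: exp_of_nat_mult)
    finally show "(24::real) \<le> exp 5" .
  qed simp
  also have "\<dots> = exp (5 * real l)" by (simp add: mult.commute flip: exp_of_nat_mult)
  finally show ?thesis .
qed

text \<open>The term 2 \<theta> l is split in two. One copy of \<theta> l is at least 20 sqrt l,
  because \<theta> sqrt l >= 20; the other is at least \<theta>^2 l >= 400 + 4 J1 and covers the
  constants.\<close>

lemma block_length_large:
  fixes J1 \<theta> :: real
  assumes "0 \<le> J1" "0 < \<theta>" "\<theta> \<le> 1" "(400 + 4 * J1) / \<theta>\<^sup>2 \<le> real l"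
  shows "4 \<le> 2 * \<theta> * real l - 4 * J1 - 8 - 16 * sqrt (real l)"
proof -
  have "20\<^sup>2 \<le> \<theta>\<^sup>2 * real l" "400 + 4 * J1 \<le> \<theta>\<^sup>2 * real l"
    using assms by (auto simp: field_simps)
  hence "20 \<le> sqrt (\<theta>\<^sup>2 * real l)" by (intro real_le_rsqrt)
  also have "\<dots> = \<theta> * sqrt (real l)" using assms by (simp add: real_sqrt_mult)
  finally have "20 * sqrt (real l) \<le> \<theta> * sqrt (real l) * sqrt (real l)" by (intro mult_right_mono) auto
  hence "20 * sqrt (real l) \<le> \<theta> * real l" by (simp add: mult.assoc)
  moreover have "\<theta>\<^sup>2 * real l \<le> \<theta> * real l"
    using assms by (intro mult_right_mono) (auto simp: power2_eq_square mult_left_le_one_le)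
  moreover have "0 \<le> sqrt (real l)" by simp
  ultimately show ?thesis using \<open>400 + 4 * J1 \<le> \<theta>\<^sup>2 * real l\<close> by linarith
qed

text \<open>Everything is measured in powers of e = exp (X / 10^6) with X = 1 / \<theta>^2. Then
  e^10 <= M <= e^11, so N^2 = M^44 is at most e^484, while exp (- 4 \<beta>), exp (- X / 2) and exp
  (- l) are each at most e^(-2400). The weakest term, 12 / M, is bounded by 12 / e^2; in all 1 + 12
  + 4 = 17 multiples of e^(-2) remain, below 1 / e since e >= 100.\<close>

lemma error_bounds:
  fixes X e :: real and M l :: nat
  defines "e \<equiv> exp (X / 10 ^ 6)"
  assumes X: "10 ^ 12 \<le> X" and M: "M = nat \<lceil>exp (X / 10 ^ 5)\<rceil>" and \<beta>: "6 / 10 ^ 4 * X \<le> \<beta>"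
    and l: "X \<le> real l"
  shows "24 * (real M ^ 22)\<^sup>2 * exp (- \<beta> * 4) \<le> exp (- X / 10 ^ 6)"
    and "12 * (real M ^ 22)\<^sup>2 * exp (- X / 2) + 12 / real M + 4 * exp (- real l) \<le> exp (- X / 10 ^ 6)"
proof -
  have "1 + X / 10 ^ 6 \<le> e" unfolding e_def by (rule exp_ge_add_one_self)
  hence e: "100 \<le> e" using X by simp
  have pow: "exp (real k * X / 10 ^ 6) = e ^ k" for k
    unfolding e_def exp_of_nat_mult[symmetric] by simp
  have e10: "exp (X / 10 ^ 5) = e ^ 10" using pow[of 10] by simp
  have Mge: "e ^ 10 \<le> real M" unfolding M e10 by (rule real_nat_ceiling_ge)
  have "real M \<le> e ^ 10 + 1"
    unfolding M e10 using e of_int_ceiling_le_add_one[of "e ^ 10"] by (simp add: of_nat_nat)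
  also have "\<dots> \<le> e ^ 10 + e ^ 10" using e by (intro add_left_mono one_le_power) auto
  also have "\<dots> \<le> e * e ^ 10" using e by simp
  finally have "real M \<le> e ^ 11" by (simp flip: power_Suc)
  hence "real M ^ 44 \<le> (e ^ 11) ^ 44" by (intro power_mono) auto
  hence M44: "(real M ^ 22)\<^sup>2 \<le> e ^ 484" by (simp flip: power_mult)
  have small: "exp (- y) \<le> 1 / e ^ 2400" if "24 / 10 ^ 4 * X \<le> y" for y
  proof -
    have "e ^ 2400 \<le> exp y" unfolding pow[symmetric] using that by simp
    thus ?thesis using e by (simp add: exp_minus field_simps)
  qed
  have main: "24 * (real M ^ 22)\<^sup>2 * exp (- y) \<le> 1 / e ^ 2" if "24 / 10 ^ 4 * X \<le> y" for y
  proof -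
    have "24 * (real M ^ 22)\<^sup>2 * exp (- y) \<le> e * e ^ 484 * (1 / e ^ 2400)"
      using e M44 small[OF that] by (intro mult_mono) auto
    also have "\<dots> = e ^ 487 / e ^ 2 / e ^ 2400" using e by (simp add: field_simps flip: power_add power_Suc)
    also have "\<dots> = 1 / e ^ 2 * (e ^ 487 / e ^ 2400)" by simp
    also have "\<dots> \<le> 1 / e ^ 2 * 1"
      using e by (intro mult_left_mono) (auto intro!: power_increasing simp: divide_le_eq)
    finally show ?thesis by simp
  qed
  have inv: "exp (- X / 10 ^ 6) = 1 / e" by (simp add: e_def exp_minus field_simps)
  have e2: "17 * (1 / e ^ 2) \<le> 1 / e" "0 \<le> 1 / e ^ 2" using e by (simp_all add: field_simps power2_eq_square)
  have "24 * (real M ^ 22)\<^sup>2 * exp (- (\<beta> * 4)) \<le> 1 / e ^ 2" using \<beta> by (intro main) simp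
  thus "24 * (real M ^ 22)\<^sup>2 * exp (- \<beta> * 4) \<le> exp (- X / 10 ^ 6)"
    unfolding inv mult_minus_left using e2 by linarith
  have "24 * (real M ^ 22)\<^sup>2 * exp (- (X / 2)) \<le> 1 / e ^ 2" using X by (intro main) simp
  moreover have "12 / real M \<le> 12 / e ^ 2"
  proof (rule divide_left_mono)
    have "e ^ 2 \<le> e ^ 10" using e by (intro power_increasing) auto
    thus "e ^ 2 \<le> real M" using Mge by simp
    moreover have "0 < e ^ 2" using e by simp
    ultimately show "0 < real M * e ^ 2" by (intro mult_pos_pos) linarith+
  qed simp
  moreover have "exp (- real l) \<le> 1 / e ^ 2"
  proof -
    have "exp (- real l) \<le> 1 / e ^ 2400" using l X by (intro small) simp
    also have "\<dots> \<le> 1 / e ^ 2" using e by (intro divide_left_mono power_increasing) auto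
    finally show ?thesis .
  qed
  moreover have "12 / e ^ 2 = 12 * (1 / e ^ 2)" by simp
  ultimately have "12 * (real M ^ 22)\<^sup>2 * exp (- (X / 2)) + 12 / real M + 4 * exp (- real l) \<le> 17 * (1 / e ^ 2)"
    using e2(2) by linarith
  thus "12 * (real M ^ 22)\<^sup>2 * exp (- X / 2) + 12 / real M + 4 * exp (- real l) \<le> exp (- X / 10 ^ 6)"
    unfolding inv minus_divide_left[of X 2, symmetric] using e2 by linarith
qed

theorem theorem2p2:
  fixes P :: "'w measure" and h :: "'w \<Rightarrow> int \<Rightarrow> real"
  assumes "prob_space P"
    and "prob_space.indep_vars P (\<lambda>_. borel) (\<lambda>i \<omega>. h \<omega> i) UNIV"
    and "\<And>i. measure P {\<omega> \<in> space P. h \<omega> i = 1} = 1/2"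
    and "\<And>i. measure P {\<omega> \<in> space P. h \<omega> i = -1} = 1/2"
  shows "\<exists>J0. \<forall>J1 \<ge> J0. \<exists>\<theta>0 > 0. \<exists>\<beta>0. \<exists>c0 > 0. \<exists>c1 > 0. \<exists>c2 > 0.
    \<forall>\<theta> \<beta>. 0 < \<theta> \<and> \<theta> \<le> \<theta>0 \<and> \<beta> > \<beta>0
      \<and> \<beta> \<ge> (1 - 2 * (sqrt 2 - 1)) / (2^8 * \<theta>^2) \<longrightarrow>
      (\<exists>E \<in> sets P. measure P E \<ge> 1 - exp (- c0 / \<theta>^2) \<and>
        (\<forall>\<omega> \<in> E. \<forall>\<mu>. gibbs_measure J1 \<beta> \<theta> (h \<omega>) \<mu> \<longrightarrow>
           measure \<mu> {\<sigma> \<in> space spin_space.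
              finite (run0 \<sigma>) \<and>
              exp (c1 / \<theta>^2) \<le> real (card (run0 \<sigma>)) \<and>
              real (card (run0 \<sigma>)) \<le> exp (c2 / \<theta>^2)}
           \<ge> 1 - exp (- c0 / \<theta>^2)))"
proof -
  interpret prob_space P by fact
  interpret coin_field P h by unfold_locales (use assms in auto)
  have main: "\<exists>E \<in> sets P. measure P E \<ge> 1 - exp (- (1 / 10 ^ 6) / \<theta>^2) \<and>
        (\<forall>\<omega> \<in> E. \<forall>\<mu>. gibbs_measure J1 \<beta> \<theta> (h \<omega>) \<mu> \<longrightarrow>
           measure \<mu> {\<sigma> \<in> space spin_space.
              finite (run0 \<sigma>) \<and>
              exp (1 / 10 ^ 5 / \<theta>^2) \<le> real (card (run0 \<sigma>)) \<and>
              real (card (run0 \<sigma>)) \<le> exp (5 * (401 + 4 * J1) / \<theta>^2)}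
           \<ge> 1 - exp (- (1 / 10 ^ 6) / \<theta>^2))"
    if J: "10 \<le> J1" and \<theta>: "0 < \<theta>" "\<theta> \<le> 1 / 10 ^ 6" and \<beta>0: "0 < \<beta>"
      and \<beta>: "(1 - 2 * (sqrt 2 - 1)) / (2^8 * \<theta>^2) \<le> \<beta>" for J1 \<theta> \<beta> :: real
  proof -
    define X where "X = 1 / \<theta>\<^sup>2"
    define M where "M = nat \<lceil>exp (X / 10 ^ 5)\<rceil>"
    define l where "l = nat \<lceil>(400 + 4 * J1) * X\<rceil>"
    have X: "10 ^ 12 \<le> X"
    proof -
      have "\<theta>\<^sup>2 \<le> (1 / 10 ^ 6)\<^sup>2" using \<theta> by (intro power_mono) auto
      hence "1 / (1 / 10 ^ 6)\<^sup>2 \<le> 1 / \<theta>\<^sup>2" using \<theta> by (intro divide_left_mono) auto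
      thus ?thesis by (simp add: X_def power_divide)
    qed
    have M: "X / 10 ^ 5 \<le> real M"
      using exp_ge_add_one_self[of "X / 10 ^ 5"] real_nat_ceiling_ge[of "exp (X / 10 ^ 5)"]
      unfolding M_def by linarith
    \<comment> \<open>The smallness of \<theta> gives X / 10^5 >= 10 / \<theta>, so M, which is at
      least X / 10^5, satisfies \<theta> M >= 6.\<close>
    have "10 ^ 6 \<le> 1 / \<theta>" using \<theta> by (simp add: field_simps)
    hence "10 ^ 6 * (1 / \<theta>) \<le> 1 / \<theta> * (1 / \<theta>)" using \<theta> by (intro mult_right_mono) auto
    hence "10 * (1 / \<theta>) \<le> X / 10 ^ 5" by (simp add: X_def power2_eq_square)
    hence "10 * (1 / \<theta>) \<le> real M" using M by simp
    hence M6: "6 \<le> \<theta> * real M" using \<theta> by (simp add: field_simps)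
    have M3: "3 \<le> M" using M X by simp
    have lge: "(400 + 4 * J1) * X \<le> real l" unfolding l_def by (rule real_nat_ceiling_ge)
    have "1 * X \<le> (400 + 4 * J1) * X" using J X by (intro mult_right_mono) auto
    hence lX: "X \<le> real l" using lge by simp
    have l1: "1 \<le> l" using lX X by simp
    have "real l \<le> (400 + 4 * J1) * X + 1"
      unfolding l_def using J X by (simp add: of_nat_nat)
    also have "\<dots> \<le> (401 + 4 * J1) * X" using X by (simp add: algebra_simps)
    finally have lle: "real l \<le> (401 + 4 * J1) * X" .
    have \<beta>': "6 / 10 ^ 4 * X \<le> \<beta>"
    proof -
      have "sqrt 2 \<le> 142 / 100" by (intro real_le_lsqrt) (auto simp: power2_eq_square)
      \<comment> \<open>Numerically 6 * 10^(-4) * 2^8 = 0.1536, while the bound 1.42 for sqrt 2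
        leaves at least 0.16 for \<zeta> = 1 - 2 (sqrt 2 - 1).\<close>
      hence "6 / 10 ^ 4 * 2 ^ 8 \<le> 1 - 2 * (sqrt 2 - 1)" by simp
      hence "6 / 10 ^ 4 * 2 ^ 8 / (2 ^ 8 * \<theta>\<^sup>2) \<le> (1 - 2 * (sqrt 2 - 1)) / (2 ^ 8 * \<theta>\<^sup>2)"
        using \<theta> by (intro divide_right_mono) auto
      thus ?thesis using \<beta> by (simp add: X_def)
    qed
    note err = error_bounds[OF X M_def \<beta>' lX]
    have c0: "exp (- (1 / 10 ^ 6) / \<theta>\<^sup>2) = exp (- X / 10 ^ 6)" by (simp add: X_def)
    have half: "- 1 / (2 * \<theta>\<^sup>2) = - X / 2" by (simp add: X_def)
    obtain E where E: "E \<in> events"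
      "1 - (12 * (real M ^ 22)\<^sup>2 * exp (- 1 / (2 * \<theta>\<^sup>2)) + 12 / real M + 4 * exp (- real l)) \<le> prob E"
      and good: "\<forall>\<omega>\<in>E. good_field \<theta> (int M) (int M ^ 10) (int M ^ 22) l (int (4 ^ l * l)) (h \<omega>)"
      using good_field_event[OF \<theta>(1) M3 M6, of l] by blast
    have params: "1 \<le> int M" "int M < int M ^ 10" "int M ^ 10 + (2 * int M ^ 10)\<^sup>2 \<le> int M ^ 22"
    proof -
      show "1 \<le> int M" using M3 by simp
      have "int M ^ 1 < int M ^ 10" using M3 by (intro power_strict_increasing) auto
      thus "int M < int M ^ 10" by simp
      have "int M ^ 10 \<le> int M ^ 20" using M3 by (intro power_increasing) auto
      moreover have "(2 * int M ^ 10)\<^sup>2 = 4 * int M ^ 20"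
        by (simp add: power_mult_distrib flip: power_mult)
      moreover have "0 \<le> int M ^ 20" by simp
      ultimately have "int M ^ 10 + (2 * int M ^ 10)\<^sup>2 \<le> 9 * int M ^ 20" by linarith
      also have "3 ^ 2 \<le> int M ^ 2" using M3 by (intro power_mono) auto
      hence "9 * int M ^ 20 \<le> int M ^ 2 * int M ^ 20" by (intro mult_right_mono) auto
      also have "\<dots> = int M ^ 22" by (simp flip: power_add)
      finally show "int M ^ 10 + (2 * int M ^ 10)\<^sup>2 \<le> int M ^ 22" .
    qed
    have lgain: "4 \<le> 2 * \<theta> * real l - 4 * J1 - 8 - 16 * sqrt (real l)"
      using J \<theta> lge by (intro block_length_large) (auto simp: X_def)
    show ?thesis
    proof (intro bexI[OF _ E(1)] conjI ballI allI impI)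
      show "1 - exp (- (1 / 10 ^ 6) / \<theta>\<^sup>2) \<le> prob E"
        using E(2) err(2) unfolding c0 half by linarith
    next
      fix \<omega> \<mu> assume \<omega>: "\<omega> \<in> E" and g: "gibbs_measure J1 \<beta> \<theta> (h \<omega>) \<mu>"
      let ?A = "{sig \<in> space spin_space. (int M \<le> int (card (run0 sig))
        \<and> int (card (run0 sig)) \<le> 2 * int (4 ^ l * l) + 1) \<and> finite (run0 sig)}"
      let ?G = "{\<sigma> \<in> space spin_space. finite (run0 \<sigma>) \<and> exp (1 / 10 ^ 5 / \<theta>\<^sup>2) \<le> real (card (run0 \<sigma>)) \<and>
              real (card (run0 \<sigma>)) \<le> exp (5 * (401 + 4 * J1) / \<theta>\<^sup>2)}"
      have "1 - 24 * (real_of_int (int M ^ 22))\<^sup>2 * exp (- \<beta> * 4) \<le> measure \<mu> ?A"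
        using gibbs_run_estimate[OF g J less_imp_le[OF \<beta>0] less_imp_le[OF \<theta>(1)] params l1
            good[rule_format, OF \<omega>] lgain] .
      hence "1 - exp (- X / 10 ^ 6) \<le> measure \<mu> ?A" using err(1) by simp
      also have "\<dots> \<le> measure \<mu> ?G"
      proof (rule finite_measure.finite_measure_mono)
        show "finite_measure \<mu>" using g by (auto simp: gibbs_measure_def prob_space_def)
        have "?G = {\<sigma> \<in> space spin_space. (exp (1 / 10 ^ 5 / \<theta>\<^sup>2) \<le> real (card (run0 \<sigma>)) \<and>
              real (card (run0 \<sigma>)) \<le> exp (5 * (401 + 4 * J1) / \<theta>\<^sup>2)) \<and> finite (run0 \<sigma>)}" by auto
        also have "\<dots> \<in> sets spin_space" by (rule sets_run0)
        finally show "?G \<in> sets \<mu>" using g by (simp add: gibbs_measure_def)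
        show "?A \<subseteq> ?G"
        proof
          fix sig assume A: "sig \<in> ?A"
          have "exp (1 / 10 ^ 5 / \<theta>\<^sup>2) = exp (X / 10 ^ 5)" by (simp add: X_def)
          also have "\<dots> \<le> real M" unfolding M_def by (rule real_nat_ceiling_ge)
          also have "\<dots> \<le> real (card (run0 sig))" using A by simp
          finally have 1: "exp (1 / 10 ^ 5 / \<theta>\<^sup>2) \<le> real (card (run0 sig))" .
          have "real_of_int (int (card (run0 sig))) \<le> real_of_int (2 * int (4 ^ l * l) + 1)"
            using A unfolding of_int_le_iff by blast
          also have "\<dots> \<le> exp (5 * real l)" by (rule run_length_bound[OF l1])
          also have "\<dots> \<le> exp (5 * ((401 + 4 * J1) * X))" using lle by simp
          also have "5 * ((401 + 4 * J1) * X) = 5 * (401 + 4 * J1) / \<theta>\<^sup>2" by (simp add: X_def)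
          finally have 2: "real (card (run0 sig)) \<le> exp (5 * (401 + 4 * J1) / \<theta>\<^sup>2)" by simp
          show "sig \<in> ?G" using A 1 2 by simp
        qed
      qed
      finally show "1 - exp (- (1 / 10 ^ 6) / \<theta>\<^sup>2) \<le> measure \<mu> ?G" unfolding c0 .
    qed
  qed
  show ?thesis
  proof (rule exI[of _ 10], intro allI impI)
    fix J1 :: real assume J: "10 \<le> J1"
    show "\<exists>\<theta>0 > 0. \<exists>\<beta>0. \<exists>c0 > 0. \<exists>c1 > 0. \<exists>c2 > 0.
    \<forall>\<theta> \<beta>. 0 < \<theta> \<and> \<theta> \<le> \<theta>0 \<and> \<beta> > \<beta>0
      \<and> \<beta> \<ge> (1 - 2 * (sqrt 2 - 1)) / (2^8 * \<theta>^2) \<longrightarrow>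
      (\<exists>E \<in> sets P. measure P E \<ge> 1 - exp (- c0 / \<theta>^2) \<and>
        (\<forall>\<omega> \<in> E. \<forall>\<mu>. gibbs_measure J1 \<beta> \<theta> (h \<omega>) \<mu> \<longrightarrow>
           measure \<mu> {\<sigma> \<in> space spin_space.
              finite (run0 \<sigma>) \<and>
              exp (c1 / \<theta>^2) \<le> real (card (run0 \<sigma>)) \<and>
              real (card (run0 \<sigma>)) \<le> exp (c2 / \<theta>^2)}
           \<ge> 1 - exp (- c0 / \<theta>^2)))"
      by (rule exI[of _ "1 / 10 ^ 6"], rule conjI, simp, rule exI[of _ 0],
          rule exI[of _ "1 / 10 ^ 6"], rule conjI, simp,
          rule exI[of _ "1 / 10 ^ 5"], rule conjI, simp,
          rule exI[of _ "5 * (401 + 4 * J1)"], rule conjI)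
         (use J in simp, intro allI impI, elim conjE, rule main[OF J])
  qed
qed

end
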